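(* Let $f,g\in\mathcal{S}(\mathbb{R}^{2d},\mathbb{H})$. Then $$D_{2d}\,\|f\|_{2,2d}^2\|g\|_{2,2d}^2\le\iint_{\mathbb{R}^{2d}\times\mathbb{R}^{2d}}\ln|w|\,|\mathcal{G}_g(f)(x,w)|^2\,d\mu_{2d}(x)\,d\mu_{2d}(w)+\|g\|_{2,2d}^2\int_{\mathbb{R}^{2d}}\ln|t|\,|f(t)|^2\,d\mu_{2d}(t),$$ where $D_{2d}=\frac{\Gamma'(d/2)}{\Gamma(d/2)}+\ln 2$.
   Context: $d\ge 1$ is an integer and $\mathbb{H}$ is the algebra of quaternions with units $i,j,k$. $\mathcal{S}(\mathbb{R}^{2d},\mathbb{H})$ is the Schwartz space of $\mathbb{H}$-valued rapidly decreasing smooth functions on $\mathbb{R}^{2d}$. On $\mathbb{R}^n$, $d\mu_n(x)=dx/(2\pi)^{n/2}$ and $\|f\|_{2,n}=\big(\int_{\mathbb{R}^n}|f|^2d\mu_n\big)^{1/2}$. The two sided quaternion windowed Fourier transform is $$\mathcal{G}_g(f)(x,w)=\int_{\mathbb{R}^{2d}}e^{-i\,s\cdot u}f(y)\overline{g(y-x)}e^{-j\,t\cdot v}\,d\mu_{2d}(y),\quad x\in\mathbb{R}^{2d},\ w=(u,v),\ y=(s,t)\in\mathbb{R}^d\times\mathbb{R}^d.$$ $|w|$, $|t|$ are Euclidean norms on $\mathbb{R}^{2d}$. *)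

theory Defs
  imports "HOL-Analysis.Analysis"
begin

datatype quat = Quat (qRe: real) (qI: real) (qJ: real) (qK: real)

lemma quat_eq_iff: "p = q \<longleftrightarrow> qRe p = qRe q \<and> qI p = qI q \<and> qJ p = qJ q \<and> qK p = qK q"
  by (cases p; cases q) simp

instantiation quat :: ring_1
begin

definition "0 = Quat 0 0 0 0"
definition "1 = Quat 1 0 0 0"
definition "p + q = Quat (qRe p + qRe q) (qI p + qI q) (qJ p + qJ q) (qK p + qK q)"
definition "p - q = Quat (qRe p - qRe q) (qI p - qI q) (qJ p - qJ q) (qK p - qK q)"
definition "- q = Quat (- qRe q) (- qI q) (- qJ q) (- qK q)"
definition "p * q = Quat
  (qRe p * qRe q - qI p * qI q - qJ p * qJ q - qK p * qK q)
  (qRe p * qI q + qI p * qRe q + qJ p * qK q - qK p * qJ q)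
  (qRe p * qJ q - qI p * qK q + qJ p * qRe q + qK p * qI q)
  (qRe p * qK q + qI p * qJ q - qJ p * qI q + qK p * qRe q)"

instance
proof
  fix p q r :: quat
  show "p * q * r = p * (q * r)"
    unfolding times_quat_def quat.sel quat.inject by (intro conjI; algebra)
  show "(p + q) * r = p * r + q * r" "p * (q + r) = p * q + p * r"
    by (simp_all add: plus_quat_def times_quat_def algebra_simps)
qed (simp_all add: quat_eq_iff zero_quat_def one_quat_def plus_quat_def minus_quat_def
      uminus_quat_def times_quat_def)

end

instantiation quat :: real_inner
begin

definition "r *\<^sub>R q = Quat (r * qRe q) (r * qI q) (r * qJ q) (r * qK q)"
definition "p \<bullet> q = qRe p * qRe q + qI p * qI q + qJ p * qJ q + qK p * qK q"
definition "norm (q :: quat) = sqrt (q \<bullet> q)"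
definition "sgn (q :: quat) = inverse (norm q) *\<^sub>R q"
definition "dist (p :: quat) q = norm (p - q)"
definition "(uniformity :: (quat \<times> quat) filter) =
  (INF e\<in>{0 <..}. principal {(p, q). dist p q < e})"
definition "open (U :: quat set) \<longleftrightarrow>
  (\<forall>p\<in>U. eventually (\<lambda>(p', q). p' = p \<longrightarrow> q \<in> U) uniformity)"

instance
proof
  fix p q s :: quat and a b :: real
  show "a *\<^sub>R (p + q) = a *\<^sub>R p + a *\<^sub>R q" "(a + b) *\<^sub>R p = a *\<^sub>R p + b *\<^sub>R p"
    "a *\<^sub>R b *\<^sub>R p = (a * b) *\<^sub>R p" "1 *\<^sub>R p = p"
    by (simp_all add: quat_eq_iff plus_quat_def scaleR_quat_def algebra_simps)
  show "p \<bullet> q = q \<bullet> p" "(p + q) \<bullet> s = p \<bullet> s + q \<bullet> s" "(a *\<^sub>R p) \<bullet> q = a * (p \<bullet> q)"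
    by (simp_all add: inner_quat_def plus_quat_def scaleR_quat_def algebra_simps)
  show "0 \<le> p \<bullet> p"
    by (simp add: inner_quat_def)
  show "p \<bullet> p = 0 \<longleftrightarrow> p = 0"
    by (simp add: inner_quat_def quat_eq_iff zero_quat_def add_nonneg_eq_0_iff)
qed (rule dist_quat_def sgn_quat_def uniformity_quat_def open_quat_def norm_quat_def)+

end

definition quat_i :: quat where "quat_i = Quat 0 1 0 0"
definition quat_j :: quat where "quat_j = Quat 0 0 1 0"
definition quat_k :: quat where "quat_k = Quat 0 0 0 1"

instantiation quat :: euclidean_space
begin

definition "Basis = {1, quat_i, quat_j, quat_k}"

instance
proof
  fix p q :: quat
  show "(Basis :: quat set) \<noteq> {}" "finite (Basis :: quat set)"
    by (simp_all add: Basis_quat_def)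
  show "p \<bullet> q = (if p = q then 1 else 0)" if "p \<in> Basis" "q \<in> Basis"
    using that unfolding Basis_quat_def
    by (elim insertE emptyE; hypsubst)
      (simp_all add: inner_quat_def one_quat_def quat_i_def quat_j_def quat_k_def)
  show "(\<forall>q\<in>Basis. p \<bullet> q = 0) \<longleftrightarrow> p = 0"
    by (cases p) (simp add: Basis_quat_def inner_quat_def one_quat_def quat_i_def quat_j_def
        quat_k_def zero_quat_def)
qed

end

instance quat :: real_normed_algebra_1
proof
  fix p q :: quat and a :: real
  show "a *\<^sub>R p * q = a *\<^sub>R (p * q)" "p * a *\<^sub>R q = a *\<^sub>R (p * q)"
    by (simp_all add: quat_eq_iff times_quat_def scaleR_quat_def algebra_simps)
  have "(p * q) \<bullet> (p * q) = (p \<bullet> p) * (q \<bullet> q)"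
    unfolding inner_quat_def times_quat_def quat.sel by algebra
  then show "norm (p * q) \<le> norm p * norm q"
    by (simp add: norm_quat_def real_sqrt_mult)
  show "norm (1 :: quat) = 1"
    by (simp add: norm_quat_def inner_quat_def one_quat_def)
qed

definition qcnj :: "quat \<Rightarrow> quat" where
  "qcnj q = Quat (qRe q) (- qI q) (- qJ q) (- qK q)"

lemma quat_units:
  "quat_i * quat_i = - 1" "quat_j * quat_j = - 1" "quat_k * quat_k = - 1"
  "quat_i * quat_j = quat_k" "quat_j * quat_k = quat_i" "quat_k * quat_i = quat_j"
  by (simp_all add: quat_i_def quat_j_def quat_k_def one_quat_def times_quat_def uminus_quat_def)

text \<open>A multi-index derivative is given by the list of the basis directions in which one
  differentiates.  Requiring every iterated partial derivative to be (totally) differentiable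
  everywhere is the same as being infinitely differentiable.\<close>

definition partial_deriv ::
    "'a :: euclidean_space \<Rightarrow> ('a \<Rightarrow> 'b :: real_normed_vector) \<Rightarrow> 'a \<Rightarrow> 'b" where
  "partial_deriv b f x = vector_derivative (\<lambda>h. f (x + h *\<^sub>R b)) (at 0)"

definition iter_partial ::
    "'a :: euclidean_space list \<Rightarrow> ('a \<Rightarrow> 'b :: real_normed_vector) \<Rightarrow> 'a \<Rightarrow> 'b" where
  "iter_partial bs f = foldr partial_deriv bs f"

definition smooth :: "('a :: euclidean_space \<Rightarrow> 'b :: real_normed_vector) \<Rightarrow> bool" where
  "smooth f \<longleftrightarrow> (\<forall>bs. set bs \<subseteq> Basis \<longrightarrow> (\<forall>x. iter_partial bs f differentiable (at x)))"

definition schwartz :: "('a :: euclidean_space \<Rightarrow> 'b :: real_normed_vector) set" where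
  "schwartz = {f. smooth f \<and>
    (\<forall>bs k. set bs \<subseteq> Basis \<longrightarrow> (\<exists>C. \<forall>x. norm x ^ k * norm (iter_partial bs f x) \<le> C))}"

definition mu :: "'a :: euclidean_space measure" where
  "mu = density lborel (\<lambda>_. ennreal (1 / (2 * pi) powr (real DIM('a) / 2)))"

definition L2_norm_mu :: "('a :: euclidean_space \<Rightarrow> 'b :: real_normed_vector) \<Rightarrow> real" where
  "L2_norm_mu f = sqrt (\<integral>x. (norm (f x))\<^sup>2 \<partial>mu)"

definition qwft ::
    "((real ^ 'd) \<times> (real ^ 'd) \<Rightarrow> quat) \<Rightarrow> ((real ^ 'd) \<times> (real ^ 'd) \<Rightarrow> quat)
      \<Rightarrow> (real ^ 'd) \<times> (real ^ 'd) \<Rightarrow> (real ^ 'd) \<times> (real ^ 'd) \<Rightarrow> quat" where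
  "qwft g f x w = (\<integral>y.
      exp (- (fst y \<bullet> fst w) *\<^sub>R quat_i) * f y * qcnj (g (y - x))
        * exp (- (snd y \<bullet> snd w) *\<^sub>R quat_j) \<partial>mu)"

end

theory Submission
  imports Defs "HOL-Probability.Probability"
begin

text \<open>The inequality is Beckner's logarithmic uncertainty principle, applied for each \<open>x\<close> to the signal
  \<open>h(y) = f(y) * qcnj (g (y - x))\<close> and integrated over \<open>x\<close>. Write \<open>H\<close> for the two sided transform of \<open>h\<close>
  and \<open>k\<^sub>t\<close> for the heat kernel on \<open>n = 2d\<close> dimensions. Expanding \<open>|H|\<^sup>2\<close> and integrating the phases against
  a Gaussian gives \<open>\<integral> exp(-t|w|\<^sup>2) |H(w)|\<^sup>2 = \<integral>\<integral> k\<^sub>t(y - y') h(y) \<bullet> h(y')\<close>, just as for the ordinary Fourier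
  transform. As \<open>t\<close> tends to \<open>0\<close> this yields Plancherel and, for Lipschitz \<open>h\<close>, enough decay of \<open>H\<close> to
  integrate \<open>ln |w|\<close> at infinity. The kernel \<open>k\<^sub>t\<close> is positive, so a Schur test with the weight \<open>|y|\<close> to the power
  \<open>-n/2\<close>, integrated against \<open>t\<close> to the power \<open>e - 1\<close>, yields Pitt's inequality with its sharp constant
  \<open>4 powr - e * Gamma (a - e) / Gamma (a + e)\<close>, \<open>a = n/4\<close>. It is an equality at \<open>e = 0\<close>, and its right derivative there
  is the claim.\<close>

section \<open>Gamma integrals on the half-line\<close>

text \<open>The two phases act on different sides of a noncommutative value, so the usual rules for
  convolutions fail for the transform itself. They survive for \<open>|H|^2\<close> damped by a
  Gaussian: the terms peculiar to two sided phases cancel there, because \<open>(s, t)\<close> and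
  \<open>(s, - t)\<close> have the same length.

  A Bochner integral that does not converge is 0, so the logarithmic term carries information only
  once \<open>ln |w| |G|^2\<close> is known to be integrable in \<open>(x, w)\<close>. Small
  \<open>w\<close> is controlled by Pitt's inequality at one fixed exponent, large \<open>w\<close>
  by the fact that the energy beyond frequency \<open>R\<close> is \<open>O(1/R)\<close>. Both
  bounds depend on \<open>x\<close> only through integrals of \<open>|h|\<close> or of
  \<open>|y|^(2e) |h|^2\<close>, with a Lipschitz constant uniform in \<open>x\<close>; hence they
  can be integrated over \<open>x\<close>, where \<open>g\<close> splits off as a factor.

  On the frequency side no limit is taken under the integral:
  \<open>1 - 2 e ln r \<le> r^(-2e)\<close> is already linear in \<open>e\<close>. Only the signal
  side uses dominated convergence, and there \<open>n \<ge> 2\<close> makes \<open>1 / |y|\<close>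
  locally integrable. The constant \<open>D\<close> is \<open>psi(n/4) + ln 2\<close> with
  \<open>n/4 = d/2\<close>.\<close>

definition half_line :: "real measure" where
  "half_line = density lborel (indicator {0<..})"

lemma sets_half_line [measurable_cong, simp]: "sets half_line = sets borel"
  by (simp add: half_line_def)

lemma space_half_line [simp]: "space half_line = UNIV"
  by (simp add: half_line_def)

text \<open>Positivity of the scale variable enters as an almost-everywhere fact of a sigma-finite
  measure, so the Tonelli exchanges carry no indicators.\<close>

lemma AE_half_line: "AE t in half_line. 0 < t"
  unfolding half_line_def by (subst AE_density) (auto simp: indicator_def)

interpretation half_line: sigma_finite_measure half_line
  unfolding half_line_def
  by (subst sigma_finite_measure.sigma_finite_iff_density_finite[OF sigma_finite_lborel]) (auto simp: indicator_def)

lemma nn_integral_half_line: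
  "f \<in> borel_measurable borel \<Longrightarrow> (\<integral>\<^sup>+t. f t \<partial>half_line) = (\<integral>\<^sup>+t. indicator {0<..} t * f t \<partial>lborel)"
  unfolding half_line_def by (subst nn_integral_density) auto

lemma nn_integral_half_line_scale:
  assumes [measurable]: "f \<in> borel_measurable borel" and "0 < c"
  shows "(\<integral>\<^sup>+t. f t \<partial>half_line) = ennreal c * (\<integral>\<^sup>+t. f (c * t) \<partial>half_line)"
proof -
  have "(\<integral>\<^sup>+t. f t \<partial>half_line) = ennreal \<bar>c\<bar> * (\<integral>\<^sup>+t. indicator {0<..} (0 + c * t) * f (0 + c * t) \<partial>lborel)"
    unfolding nn_integral_half_line[OF assms(1)]
    using assms(2) by (intro nn_integral_real_affine) auto
  also have "(\<integral>\<^sup>+t. indicator {0<..} (0 + c * t) * f (0 + c * t) \<partial>lborel) = (\<integral>\<^sup>+t. f (c * t) \<partial>half_line)"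
    using assms(2) by (subst nn_integral_half_line)
      (auto simp: indicator_def zero_less_mult_iff intro!: nn_integral_cong)
  finally show ?thesis using assms(2) by simp
qed

lemma nn_integral_cong_half_line:
  "(\<And>t. 0 < t \<Longrightarrow> f t = g t) \<Longrightarrow> (\<integral>\<^sup>+t. f t \<partial>half_line) = (\<integral>\<^sup>+t. g t \<partial>half_line)"
  by (intro nn_integral_cong_AE eventually_mono[OF AE_half_line])

lemma nn_integral_Gamma:
  fixes b c :: real
  assumes "0 < b" "0 < c"
  shows "(\<integral>\<^sup>+s. ennreal (s powr (b - 1) * exp (- (c * s))) \<partial>half_line) = ennreal (Gamma b * c powr - b)"
proof -
  have "ennreal (Gamma b) = (\<integral>\<^sup>+s. ennreal (s powr (b - 1) * exp (- s)) \<partial>half_line)"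
    using assms
    by (subst Gamma_conv_nn_integral_real)
      (auto simp: nn_integral_half_line exp_minus divide_inverse indicator_def
        intro!: nn_integral_cong)
  also have "\<dots> = ennreal c * (\<integral>\<^sup>+s. ennreal ((c * s) powr (b - 1) * exp (- (c * s))) \<partial>half_line)"
    using assms by (intro nn_integral_half_line_scale) auto
  also have "\<dots> = ennreal c * (\<integral>\<^sup>+s. ennreal (c powr (b - 1)) * ennreal (s powr (b - 1) * exp (- (c * s))) \<partial>half_line)"
    using assms
    by (intro arg_cong2[where f="(*)"] refl nn_integral_cong_half_line)
      (auto simp: powr_mult ennreal_mult'[symmetric] mult_ac)
  also have "\<dots> = ennreal (c powr b) * (\<integral>\<^sup>+s. ennreal (s powr (b - 1) * exp (- (c * s))) \<partial>half_line)"
    using assms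
    by (subst nn_integral_cmult)
      (auto simp: mult.assoc[symmetric] ennreal_mult'[symmetric] powr_mult_base)
  finally have 1: "ennreal (Gamma b) = ennreal (c powr b) * (\<integral>\<^sup>+s. ennreal (s powr (b - 1) * exp (- (c * s))) \<partial>half_line)"
    (is "_ = _ * ?I") .
  have 2: "ennreal (c powr - b) * ennreal (c powr b) = 1"
    using assms by (simp add: ennreal_mult'[symmetric] powr_add[symmetric])
  have "ennreal (Gamma b * c powr - b) = ennreal (c powr - b) * ennreal (Gamma b)"
    by (subst ennreal_mult'[symmetric]) (simp_all add: mult.commute)
  also have "\<dots> = ?I"
    unfolding 1 mult.assoc[symmetric] 2 by simp
  finally show ?thesis ..
qed

text \<open>The Gamma integral solved for the power. Through it every negative power below becomes a
  superposition of exponentials, hence of Gaussians when \<open>c\<close> is a squared norm.\<close>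

lemma powr_neg_eq_nn_integral:
  fixes b c :: real
  assumes "0 < b" "0 < c"
  shows "ennreal (c powr - b) = ennreal (1 / Gamma b) * (\<integral>\<^sup>+s. ennreal (s powr (b - 1) * exp (- (c * s))) \<partial>half_line)"
  using assms by (simp add: nn_integral_Gamma ennreal_mult'[symmetric] Gamma_real_pos less_imp_le less_imp_neq[symmetric])

text \<open>Euler's beta function \<open>B(e, c)\<close> in its half-line form. Writing the power of
  \<open>1 + p\<close> as a superposition of \<open>exp (- ((1 + p) * s))\<close> and exchanging the
  integrals leaves one Gamma integral in \<open>p\<close> and one in \<open>s\<close>.\<close>

lemma nn_integral_beta_prime:
  fixes e c :: real
  assumes "0 < e" "0 < c"
  shows "(\<integral>\<^sup>+p. ennreal (p powr (e - 1) * (1 + p) powr - (c + e)) \<partial>half_line) =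
    ennreal (Gamma e * Gamma c / Gamma (c + e))"
proof -
  interpret pair_sigma_finite half_line half_line ..
  have g: "Gamma (c + e) > 0" "Gamma c > 0" "Gamma e > 0"
    using assms by (auto intro!: Gamma_real_pos)
  have "(\<integral>\<^sup>+p. ennreal (p powr (e - 1) * (1 + p) powr - (c + e)) \<partial>half_line) =
    (\<integral>\<^sup>+p. ennreal (1 / Gamma (c + e)) * (\<integral>\<^sup>+s. ennreal (p powr (e - 1) * (s powr (c + e - 1) * exp (- ((1 + p) * s)))) \<partial>half_line) \<partial>half_line)"
  proof (intro nn_integral_cong_half_line)
    fix p :: real assume p: "0 < p"
    have "ennreal (p powr (e - 1) * (1 + p) powr - (c + e)) =
        ennreal (1 / Gamma (c + e)) * (ennreal (p powr (e - 1)) * (\<integral>\<^sup>+s. ennreal (s powr (c + e - 1) * exp (- ((1 + p) * s))) \<partial>half_line))"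
      using p assms by (simp only: ennreal_mult' powr_ge_zero powr_neg_eq_nn_integral) (simp add: mult_ac)
    also have "ennreal (p powr (e - 1)) * (\<integral>\<^sup>+s. ennreal (s powr (c + e - 1) * exp (- ((1 + p) * s))) \<partial>half_line) =
       (\<integral>\<^sup>+s. ennreal (p powr (e - 1) * (s powr (c + e - 1) * exp (- ((1 + p) * s)))) \<partial>half_line)"
      by (subst nn_integral_cmult[symmetric]) (auto simp: ennreal_mult')
    finally show "ennreal (p powr (e - 1) * (1 + p) powr - (c + e)) = ennreal (1 / Gamma (c + e)) * \<dots>" .
  qed
  also have "\<dots> = ennreal (1 / Gamma (c + e)) * (\<integral>\<^sup>+s. \<integral>\<^sup>+p. ennreal (p powr (e - 1) * (s powr (c + e - 1) * exp (- ((1 + p) * s)))) \<partial>half_line \<partial>half_line)"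
    by (subst nn_integral_cmult, measurable) (subst Fubini', auto)
  also have "(\<integral>\<^sup>+s. \<integral>\<^sup>+p. ennreal (p powr (e - 1) * (s powr (c + e - 1) * exp (- ((1 + p) * s)))) \<partial>half_line \<partial>half_line)
     = (\<integral>\<^sup>+s. ennreal (Gamma e) * ennreal (s powr (c - 1) * exp (- (1 * s))) \<partial>half_line)"
  proof (intro nn_integral_cong_half_line)
    fix s :: real assume s: "0 < s"
    have "(\<integral>\<^sup>+p. ennreal (p powr (e - 1) * (s powr (c + e - 1) * exp (- ((1 + p) * s)))) \<partial>half_line) =
      (\<integral>\<^sup>+p. ennreal (s powr (c + e - 1) * exp (- s)) * ennreal (p powr (e - 1) * exp (- (s * p))) \<partial>half_line)"
      by (intro nn_integral_cong) (simp add: ennreal_mult'[symmetric] algebra_simps exp_add exp_diff exp_minus divide_inverse)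
    also have "\<dots> = ennreal (s powr (c + e - 1) * exp (- s)) * ennreal (Gamma e * s powr - e)"
      using s assms by (subst nn_integral_cmult) (auto simp: nn_integral_Gamma)
    also have "\<dots> = ennreal (Gamma e) * ennreal (s powr (c - 1) * exp (- (1 * s)))"
      using s assms g
      by (simp add: ennreal_mult'[symmetric] mult_ac powr_add[symmetric])
    finally show "(\<integral>\<^sup>+p. ennreal (p powr (e - 1) * (s powr (c + e - 1) * exp (- ((1 + p) * s)))) \<partial>half_line) = \<dots>" .
  qed
  also have "\<dots> = ennreal (Gamma e * Gamma c)"
    using nn_integral_Gamma[of c 1] assms g by (subst nn_integral_cmult) (auto simp: ennreal_mult'[symmetric])
  finally show ?thesis
    using g by (simp add: ennreal_mult'[symmetric])
qed

section \<open>Gaussians and the heat kernel\<close>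

lemma gaussian_fourier_real:
  fixes c z :: real
  assumes "0 < c"
  shows "has_bochner_integral lborel (\<lambda>x. complex_of_real (exp (- (c * x\<^sup>2))) * cis (z * x))
    (complex_of_real (sqrt (pi / c) * exp (- z\<^sup>2 / (4 * c))))"
proof -
  \<comment> \<open>With this scale \<open>(s * x)\<^sup>2 / 2 = c * x\<^sup>2\<close>, so the claim
    is a rescaled value of the characteristic function of the standard normal law, taken at
    \<open>z / s\<close>.\<close>
  define s where "s = sqrt (2 * c)"
  have s: "s > 0" "s * s = 2 * c" using assms by (auto simp: s_def)
  interpret S: prob_space std_normal_distribution
    by (rule prob_space_normal_density) simp
  have i: "integrable std_normal_distribution (\<lambda>x. iexp (z / s * x))"
    by (intro S.integrable_const_bound[where B=1] AE_I2) auto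
  have "has_bochner_integral std_normal_distribution (\<lambda>x. iexp (z / s * x)) (exp (- (z / s)\<^sup>2 / 2))"
    using i fun_cong[OF char_std_normal_distribution, of "z / s"]
    by (simp add: has_bochner_integral_iff char_def)
  then have "has_bochner_integral lborel (\<lambda>x. std_normal_density x *\<^sub>R iexp (z / s * x)) (exp (- (z / s)\<^sup>2 / 2))"
    by (simp add: has_bochner_integral_iff integrable_density integral_density)
  then have "has_bochner_integral lborel (\<lambda>x. std_normal_density (0 + s * x) *\<^sub>R iexp (z / s * (0 + s * x))) (complex_of_real (exp (- (z / s)\<^sup>2 / 2)) /\<^sub>R \<bar>s\<bar>)"
    by (rule lborel_has_bochner_integral_real_affine_iff[where c=s and t=0, THEN iffD1, rotated]) (use s(1) in simp)
  then have "has_bochner_integral lborel (\<lambda>x. complex_of_real (sqrt (2 * pi)) * (std_normal_density (0 + s * x) *\<^sub>R iexp (z / s * (0 + s * x))))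
     (complex_of_real (sqrt (2 * pi)) * (complex_of_real (exp (- (z / s)\<^sup>2 / 2)) /\<^sub>R \<bar>s\<bar>))"
    by (rule has_bochner_integral_mult_right)
  also have "(\<lambda>x. complex_of_real (sqrt (2 * pi)) * (std_normal_density (0 + s * x) *\<^sub>R iexp (z / s * (0 + s * x)))) =
     (\<lambda>x. complex_of_real (exp (- (c * x\<^sup>2))) * cis (z * x))"
  proof
    fix x
    have "(s * x)\<^sup>2 / 2 = c * x\<^sup>2" using s by (simp add: power2_eq_square)
    then have "sqrt (2 * pi) * std_normal_density (s * x) = exp (- (c * x\<^sup>2))"
      by (simp add: std_normal_density_def)
    then have "complex_of_real (exp (- (c * x\<^sup>2))) = complex_of_real (sqrt (2 * pi)) * complex_of_real (std_normal_density (s * x))"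
      by (metis of_real_mult)
    then show "complex_of_real (sqrt (2 * pi)) * (std_normal_density (0 + s * x) *\<^sub>R iexp (z / s * (0 + s * x))) =
      complex_of_real (exp (- (c * x\<^sup>2))) * cis (z * x)"
      using s(1) by (simp add: scaleR_conv_of_real cis_conv_exp mult_ac)
  qed
  also have "complex_of_real (sqrt (2 * pi)) * (complex_of_real (exp (- (z / s)\<^sup>2 / 2)) /\<^sub>R \<bar>s\<bar>) =
     complex_of_real (sqrt (pi / c) * exp (- z\<^sup>2 / (4 * c)))"
  proof -
    have 1: "sqrt (2 * pi) = sqrt (pi / c) * s"
      using assms by (simp add: s_def real_sqrt_mult[symmetric])
    have 2: "- (z / s)\<^sup>2 / 2 = - z\<^sup>2 / (4 * c)"
      using s by (simp add: power2_eq_square)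
    have "sqrt (2 * pi) * (exp (- (z / s)\<^sup>2 / 2) / s) = sqrt (pi / c) * exp (- z\<^sup>2 / (4 * c))"
      unfolding 1 2 using s(1) by simp
    moreover have "complex_of_real (sqrt (2 * pi)) * (complex_of_real (exp (- (z / s)\<^sup>2 / 2)) /\<^sub>R \<bar>s\<bar>) =
        complex_of_real (sqrt (2 * pi) * (exp (- (z / s)\<^sup>2 / 2) / s))"
      using s(1) by (simp only: scaleR_conv_of_real of_real_mult divide_inverse abs_of_pos mult_ac)
    ultimately show ?thesis by (simp only:)
  qed
  finally show ?thesis .
qed

lemma norm_sq_sum_Basis: "(norm (x::'a::euclidean_space))\<^sup>2 = (\<Sum>b\<in>Basis. (x \<bullet> b)\<^sup>2)"
  unfolding power2_norm_eq_inner by (subst euclidean_inner) (simp add: power2_eq_square)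

lemma cis_sum: "finite A \<Longrightarrow> cis (\<Sum>b\<in>A. f b) = (\<Prod>b\<in>A. cis (f b))"
  by (induction A rule: finite_induct) (auto simp: cis_mult[symmetric])

text \<open>Squared norm and inner product are sums over coordinates, so the integrand factors into
  one-dimensional ones, and \<open>lborel\<close> is the image of the product measure under the
  coordinate map.\<close>

lemma gaussian_fourier_lborel:
  fixes z :: "'a :: euclidean_space" and c :: real
  assumes "0 < c"
  shows "has_bochner_integral lborel (\<lambda>x::'a. complex_of_real (exp (- (c * (norm x)\<^sup>2))) * cis (z \<bullet> x))
    (complex_of_real ((pi / c) powr (DIM('a) / 2) * exp (- (norm z)\<^sup>2 / (4 * c))))"
proof -
  interpret product_sigma_finite "\<lambda>b::'a. lborel :: real measure" ..
  let ?f = "\<lambda>b x. complex_of_real (exp (- (c * x\<^sup>2))) * cis ((z \<bullet> b) * x)"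
  note 1 = gaussian_fourier_real[OF assms, unfolded has_bochner_integral_iff]
  have *: "(\<lambda>x::'a. complex_of_real (exp (- (c * (norm x)\<^sup>2))) * cis (z \<bullet> x)) = (\<lambda>x. \<Prod>b\<in>Basis. ?f b (x \<bullet> b))"
  proof
    fix x :: 'a
    have 1: "complex_of_real (exp (- (c * (norm x)\<^sup>2))) = (\<Prod>b\<in>Basis. complex_of_real (exp (- (c * (x \<bullet> b)\<^sup>2))))"
      by (simp add: norm_sq_sum_Basis sum_distrib_left exp_sum flip: sum_negf)
    have 2: "cis (z \<bullet> x) = (\<Prod>b\<in>Basis. cis ((z \<bullet> b) * (x \<bullet> b)))"
      by (subst euclidean_inner) (simp add: cis_sum)
    show "complex_of_real (exp (- (c * (norm x)\<^sup>2))) * cis (z \<bullet> x) = (\<Prod>b\<in>Basis. ?f b (x \<bullet> b))"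
      unfolding 1 2 prod.distrib ..
  qed
  have mp: "(\<lambda>x::'a. \<Prod>b\<in>Basis. ?f b (x \<bullet> b)) \<in> borel_measurable borel"
    by (intro borel_measurable_continuous_onI continuous_intros)
  have m: "(\<lambda>f. \<Sum>b\<in>Basis. f b *\<^sub>R b) \<in> (\<Pi>\<^sub>M b\<in>Basis. lborel) \<rightarrow>\<^sub>M (borel :: 'a measure)"
    by measurable
  have c: "(\<Prod>b\<in>Basis. ?f b ((\<Sum>b'\<in>Basis. g b' *\<^sub>R b') \<bullet> b)) = (\<Prod>b\<in>(Basis::'a set). ?f b (g b))" for g
    by (intro prod.cong) auto
  have val: "(\<Prod>b\<in>(Basis::'a set). complex_of_real (sqrt (pi / c) * exp (- (z \<bullet> b)\<^sup>2 / (4 * c)))) =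
    complex_of_real ((pi / c) powr (DIM('a) / 2) * exp (- (norm z)\<^sup>2 / (4 * c)))"
  proof -
    have "(\<Prod>b\<in>(Basis::'a set). exp (- (z \<bullet> b)\<^sup>2 / (4 * c))) = exp (- (norm z)\<^sup>2 / (4 * c))"
      by (simp add: norm_sq_sum_Basis exp_sum[symmetric] sum_negf sum_divide_distrib)
    moreover have "sqrt (pi / c) ^ DIM('a) = (pi / c) powr (DIM('a) / 2)"
      using assms by (simp add: powr_half_sqrt[symmetric] powr_powr flip: powr_realpow)
    ultimately show ?thesis
      unfolding of_real_prod[symmetric] prod.distrib by simp
  qed
  have "integrable (lborel::'a measure) (\<lambda>x. \<Prod>b\<in>Basis. ?f b (x \<bullet> b))"
    by (subst lborel_eq, subst integrable_distr_eq[OF m])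
      (rule mp, simp only: c, intro product_integrable_prod, use 1 in auto)
  moreover have "integral\<^sup>L (lborel::'a measure) (\<lambda>x. \<Prod>b\<in>Basis. ?f b (x \<bullet> b)) = (\<Prod>b\<in>Basis. integral\<^sup>L lborel (?f b))"
    by (subst lborel_eq, subst integral_distr[OF m])
      (rule mp, simp only: c, intro product_integral_prod, use 1 in auto)
  ultimately show ?thesis
    using 1 val unfolding * has_bochner_integral_iff by simp
qed

section \<open>The normalised measure: invariance, Gaussians and the heat kernel\<close>

lemma sets_mu [measurable_cong, simp]: "sets mu = sets borel"
  by (simp add: mu_def)

lemma space_mu [simp]: "space mu = UNIV"
  by (simp add: mu_def)

interpretation mu: sigma_finite_measure "mu :: 'a::euclidean_space measure"
  unfolding mu_def
  by (subst sigma_finite_measure.sigma_finite_iff_density_finite[OF sigma_finite_lborel]) auto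

interpretation mu2: pair_sigma_finite "mu :: 'a::euclidean_space measure" "mu :: 'b::euclidean_space measure" ..

lemma nn_integral_mu:
  fixes f :: "'a::euclidean_space \<Rightarrow> ennreal"
  assumes "f \<in> borel_measurable borel"
  shows "(\<integral>\<^sup>+x. f x \<partial>mu) = ennreal (1 / (2 * pi) powr (real DIM('a) / 2)) * (\<integral>\<^sup>+x. f x \<partial>lborel)"
  unfolding mu_def using assms by (simp add: nn_integral_density nn_integral_cmult)

lemma has_bochner_integral_mu:
  fixes f :: "'a::euclidean_space \<Rightarrow> 'b :: {banach, second_countable_topology}"
  assumes "has_bochner_integral lborel f I"
  shows "has_bochner_integral mu f ((1 / (2 * pi) powr (real DIM('a) / 2)) *\<^sub>R I)"
  using assms borel_measurable_has_bochner_integral[OF assms] unfolding mu_def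
  by (subst has_bochner_integral_density) (auto intro!: has_bochner_integral_scaleR_right)

lemma AE_mu_neq: "AE x in mu. x \<noteq> (a::'a::euclidean_space)"
  unfolding mu_def by (subst AE_density) (auto intro: AE_mp[OF AE_lborel_singleton[of a]])

lemma nn_integral_mu_translate:
  fixes f :: "'a::euclidean_space \<Rightarrow> ennreal"
  assumes [measurable]: "f \<in> borel_measurable borel"
  shows "(\<integral>\<^sup>+x. f (a + x) \<partial>mu) = (\<integral>\<^sup>+x. f x \<partial>mu)"
proof -
  have "(\<integral>\<^sup>+x. f x \<partial>lborel) = (\<integral>\<^sup>+x. f x \<partial>distr lborel borel ((+) a))"
    by (simp add: lborel_distr_plus)
  also have "\<dots> = (\<integral>\<^sup>+x. f (a + x) \<partial>lborel)"
    by (subst nn_integral_distr) auto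
  finally show ?thesis by (simp add: nn_integral_mu)
qed

lemma nn_integral_mu_reflect:
  fixes f :: "'a::euclidean_space \<Rightarrow> ennreal"
  assumes [measurable]: "f \<in> borel_measurable borel"
  shows "(\<integral>\<^sup>+x. f (a - x) \<partial>mu) = (\<integral>\<^sup>+x. f x \<partial>mu)"
proof -
  have "(\<integral>\<^sup>+x. f x \<partial>lborel) = (\<integral>\<^sup>+x. f x \<partial>density (distr lborel borel (\<lambda>x. a + (- 1) *\<^sub>R x)) (\<lambda>_. ennreal (\<bar>- 1\<bar>^DIM('a))))"
    using lborel_affine[of "- 1" a] by simp
  also have "\<dots> = (\<integral>\<^sup>+x. f (a - x) \<partial>lborel)"
    by (subst nn_integral_density, simp, simp, subst nn_integral_distr) auto
  finally show ?thesis by (simp add: nn_integral_mu)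
qed

lemma gaussian_fourier_mu:
  fixes z :: "'a :: euclidean_space" and c :: real
  assumes "0 < c"
  shows "has_bochner_integral mu (\<lambda>x::'a. complex_of_real (exp (- (c * (norm x)\<^sup>2))) * cis (z \<bullet> x))
    (complex_of_real ((2 * c) powr - (DIM('a) / 2) * exp (- (norm z)\<^sup>2 / (4 * c))))"
proof -
  have "1 / (2 * pi) powr (DIM('a) / 2) * (pi / c) powr (DIM('a) / 2) = (2 * c) powr - (DIM('a) / 2)"
    using assms by (simp add: powr_mult powr_divide powr_minus field_simps)
  then have "(1 / (2 * pi) powr (real DIM('a) / 2)) *\<^sub>R complex_of_real ((pi / c) powr (DIM('a) / 2) * exp (- (norm z)\<^sup>2 / (4 * c))) =
    complex_of_real ((2 * c) powr - (DIM('a) / 2) * exp (- (norm z)\<^sup>2 / (4 * c)))"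
    unfolding scaleR_conv_of_real of_real_mult[symmetric] mult.assoc[symmetric] by (simp only:)
  then show ?thesis
    using has_bochner_integral_mu[OF gaussian_fourier_lborel[OF assms, of z]]
    by (simp only:)
qed

lemma gaussian_cos_mu:
  fixes z :: "'a :: euclidean_space"
  assumes "0 < c"
  shows "has_bochner_integral mu (\<lambda>x. exp (- (c * (norm x)\<^sup>2)) * cos (z \<bullet> x))
    ((2 * c) powr - (DIM('a) / 2) * exp (- (norm z)\<^sup>2 / (4 * c)))"
  using has_bochner_integral_bounded_linear[OF bounded_linear_Re gaussian_fourier_mu[OF assms, of z]]
  by simp

lemma gaussian_sin_mu:
  fixes z :: "'a :: euclidean_space"
  assumes "0 < c"
  shows "has_bochner_integral mu (\<lambda>x. exp (- (c * (norm x)\<^sup>2)) * sin (z \<bullet> x)) 0"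
  using has_bochner_integral_bounded_linear[OF bounded_linear_Im gaussian_fourier_mu[OF assms, of z]]
  by simp

lemma gaussian_mu:
  assumes "0 < c"
  shows "has_bochner_integral (mu :: 'a::euclidean_space measure) (\<lambda>x. exp (- (c * (norm x)\<^sup>2))) ((2 * c) powr - (DIM('a) / 2))"
  using gaussian_cos_mu[OF assms, of "0::'a"] by simp

lemma nn_integral_gaussian_mu:
  assumes "0 < c"
  shows "(\<integral>\<^sup>+x. ennreal (exp (- (c * (norm (x::'a::euclidean_space))\<^sup>2))) \<partial>mu) = ennreal ((2 * c) powr - (DIM('a) / 2))"
  using gaussian_mu[OF assms, where 'a='a] by (simp add: has_bochner_integral_iff nn_integral_eq_integral)

text \<open>The transform under \<open>mu\<close> of the Gaussian \<open>exp (- t |w|^2)\<close>.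
  The classical heat kernel has the factor \<open>(4 pi t)^(-n/2)\<close>; passing to
  \<open>mu\<close> multiplies it by \<open>(2 pi)^(n/2)\<close>, which keeps the total mass equal
  to one.\<close>

definition heat_kernel :: "real \<Rightarrow> 'a::euclidean_space \<Rightarrow> real" where
  "heat_kernel t z = (2 * t) powr - (DIM('a) / 2) * exp (- ((norm z)\<^sup>2 / (4 * t)))"

lemma heat_kernel_nonneg [simp]: "0 \<le> heat_kernel t z"
  by (simp add: heat_kernel_def)

lemma heat_kernel_minus_commute: "heat_kernel t (x - y) = heat_kernel t (y - x)"
  by (simp add: heat_kernel_def norm_minus_commute)

lemma measurable_heat_kernel [measurable]:
  "(\<lambda>(t, z). heat_kernel t z) \<in> borel_measurable (borel \<Otimes>\<^sub>M borel)"
  unfolding heat_kernel_def by measurable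

lemma nn_integral_heat_kernel:
  assumes "0 < t"
  shows "(\<integral>\<^sup>+z. ennreal (heat_kernel t (z::'a::euclidean_space)) \<partial>mu) = 1"
proof -
  have "(\<integral>\<^sup>+z. ennreal (heat_kernel t (z::'a)) \<partial>mu) =
    (\<integral>\<^sup>+z. ennreal ((2 * t) powr - (DIM('a) / 2)) * ennreal (exp (- (1 / (4 * t) * (norm (z::'a))\<^sup>2))) \<partial>mu)"
    by (intro nn_integral_cong) (simp add: heat_kernel_def ennreal_mult'[symmetric])
  also have "\<dots> = ennreal ((2 * t) powr - (DIM('a) / 2)) * ennreal ((2 * (1 / (4 * t))) powr - (DIM('a) / 2))"
    using nn_integral_gaussian_mu[of "1 / (4 * t)", where 'a='a] assms
    by (subst nn_integral_cmult) auto
  also have "\<dots> = 1"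
    using assms by (simp add: ennreal_mult'[symmetric] powr_mult[symmetric])
  finally show ?thesis .
qed

lemma heat_kernel_gaussian:
  fixes x :: "'a::euclidean_space"
  assumes t: "0 < t" and s: "0 < s"
  shows "(\<integral>\<^sup>+y. ennreal (heat_kernel t (x - y) * exp (- (s * (norm y)\<^sup>2))) \<partial>mu) =
    ennreal ((1 + 4 * s * t) powr - (DIM('a) / 2) * exp (- (s / (1 + 4 * s * t) * (norm x)\<^sup>2)))"
proof -
  define q where "q = 1 + 4 * s * t"
  have q: "q > 0" using t s by (simp add: q_def add_pos_pos)
  let ?A = "(2 * t) powr - (DIM('a) / 2) * exp (- (s / q * (norm x)\<^sup>2))"
  \<comment> \<open>Completing the square in \<open>y\<close> moves the centre to
    \<open>x / q\<close>; translation invariance of \<open>mu\<close> then disposes of the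
    centre.\<close>
  have sq: "(norm (x - y))\<^sup>2 / (4 * t) + s * (norm y)\<^sup>2 =
     s / q * (norm x)\<^sup>2 + q / (4 * t) * (norm (- (1 / q) *\<^sub>R x + y))\<^sup>2" for y
  proof -
    have 1: "(norm (x - y))\<^sup>2 = (norm x)\<^sup>2 - 2 * (x \<bullet> y) + (norm y)\<^sup>2"
      unfolding power2_norm_eq_inner by (simp add: inner_diff_left inner_diff_right inner_commute)
    have 2: "(norm (- (1 / q) *\<^sub>R x + y))\<^sup>2 = (norm x)\<^sup>2 / q\<^sup>2 - 2 * (x \<bullet> y) / q + (norm y)\<^sup>2"
      unfolding power2_norm_eq_inner
      by (simp add: inner_diff_left inner_diff_right inner_commute power2_eq_square)
    show ?thesis unfolding 1 2
      using q t by (simp add: divide_simps power2_eq_square) (simp add: q_def algebra_simps)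
  qed
  have "(\<integral>\<^sup>+y. ennreal (heat_kernel t (x - y) * exp (- (s * (norm y)\<^sup>2))) \<partial>mu) =
    (\<integral>\<^sup>+y. ennreal ?A * ennreal (exp (- (q / (4 * t) * (norm (- (1 / q) *\<^sub>R x + y))\<^sup>2))) \<partial>mu)"
  proof (intro nn_integral_cong)
    fix y
    have "exp (- ((norm (x - y))\<^sup>2 / (4 * t))) * exp (- (s * (norm y)\<^sup>2)) =
      exp (- (s / q * (norm x)\<^sup>2)) * exp (- (q / (4 * t) * (norm (- (1 / q) *\<^sub>R x + y))\<^sup>2))"
      unfolding mult_exp_exp using sq[of y] by simp
    then show "ennreal (heat_kernel t (x - y) * exp (- (s * (norm y)\<^sup>2))) = ennreal ?A * ennreal (exp (- (q / (4 * t) * (norm (- (1 / q) *\<^sub>R x + y))\<^sup>2)))"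
      by (simp add: heat_kernel_def ennreal_mult'[symmetric] mult.assoc)
  qed
  also have "\<dots> = ennreal ?A * (\<integral>\<^sup>+y. ennreal (exp (- (q / (4 * t) * (norm (y::'a))\<^sup>2))) \<partial>mu)"
    by (subst nn_integral_cmult, measurable) (subst nn_integral_mu_translate, auto)
  also have "\<dots> = ennreal ?A * ennreal ((2 * (q / (4 * t))) powr - (DIM('a) / 2))"
    using q t by (subst nn_integral_gaussian_mu) auto
  also have "\<dots> = ennreal (((2 * t) * (2 * (q / (4 * t)))) powr - (DIM('a) / 2) * exp (- (s / q * (norm x)\<^sup>2)))"
    using q t by (subst powr_mult) (auto simp: ennreal_mult'[symmetric] mult_ac)
  also have "(2 * t) * (2 * (q / (4 * t))) = q" using t by simp
  finally show ?thesis by (simp add: q_def)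
qed

section \<open>Riesz potentials of inverse powers\<close>

lemma norm_powr_eq_nn_integral:
  fixes y :: "'a::euclidean_space"
  assumes "0 < b" "y \<noteq> 0"
  shows "ennreal (norm y powr - (2 * b)) =
    ennreal (1 / Gamma b) * (\<integral>\<^sup>+s. ennreal (s powr (b - 1) * exp (- (s * (norm y)\<^sup>2))) \<partial>half_line)"
proof -
  have "norm y powr - (2 * b) = ((norm y)\<^sup>2) powr - b"
    using assms(2) by (simp add: powr_powr flip: powr_numeral)
  then show ?thesis
    using powr_neg_eq_nn_integral[of b "(norm y)\<^sup>2"] assms by (simp add: mult.commute)
qed

interpretation half_mu: pair_sigma_finite half_line "mu :: 'a::euclidean_space measure" ..
interpretation half_half: pair_sigma_finite half_line half_line ..

text \<open>Subordination: the inverse power is a superposition over \<open>s\<close> of Gaussians,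
  and the heat flow takes each of them to another Gaussian. The point \<open>y = 0\<close>, where
  \<open>powr\<close> has the default value 0, is a null set.\<close>

lemma heat_flow_inverse_power:
  fixes x :: "'a::euclidean_space"
  assumes t: "0 < t" and a: "0 < a"
  shows "(\<integral>\<^sup>+y. ennreal (heat_kernel t (x - y) * norm y powr - (2 * a)) \<partial>mu) =
    ennreal (1 / Gamma a) * (\<integral>\<^sup>+s. ennreal (s powr (a - 1) * ((1 + 4 * s * t) powr - (DIM('a) / 2) *
      exp (- (s / (1 + 4 * s * t) * (norm x)\<^sup>2)))) \<partial>half_line)"
proof -
  have "(\<integral>\<^sup>+y. ennreal (heat_kernel t (x - y) * norm y powr - (2 * a)) \<partial>mu) =
    (\<integral>\<^sup>+y. ennreal (1 / Gamma a) * (\<integral>\<^sup>+s. ennreal (s powr (a - 1) * (heat_kernel t (x - y) * exp (- (s * (norm y)\<^sup>2)))) \<partial>half_line) \<partial>mu)"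
  proof (intro nn_integral_cong_AE eventually_mono[OF AE_mu_neq[of 0]])
    fix y :: 'a assume y: "y \<noteq> 0"
    have "ennreal (heat_kernel t (x - y) * norm y powr - (2 * a)) =
      ennreal (1 / Gamma a) * (ennreal (heat_kernel t (x - y)) * (\<integral>\<^sup>+s. ennreal (s powr (a - 1) * exp (- (s * (norm y)\<^sup>2))) \<partial>half_line))"
      using norm_powr_eq_nn_integral[OF a y] by (simp add: ennreal_mult' mult_ac)
    also have "ennreal (heat_kernel t (x - y)) * (\<integral>\<^sup>+s. ennreal (s powr (a - 1) * exp (- (s * (norm y)\<^sup>2))) \<partial>half_line) =
      (\<integral>\<^sup>+s. ennreal (s powr (a - 1) * (heat_kernel t (x - y) * exp (- (s * (norm y)\<^sup>2)))) \<partial>half_line)"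
      by (subst nn_integral_cmult[symmetric]) (auto simp: ennreal_mult'[symmetric] mult_ac)
    finally show "ennreal (heat_kernel t (x - y) * norm y powr - (2 * a)) = ennreal (1 / Gamma a) * \<dots>" .
  qed
  also have "\<dots> = ennreal (1 / Gamma a) * (\<integral>\<^sup>+s. \<integral>\<^sup>+y. ennreal (s powr (a - 1) * (heat_kernel t (x - y) * exp (- (s * (norm y)\<^sup>2)))) \<partial>mu \<partial>half_line)"
    by (subst nn_integral_cmult, measurable) (subst half_mu.Fubini', auto)
  also have "(\<integral>\<^sup>+s. \<integral>\<^sup>+y. ennreal (s powr (a - 1) * (heat_kernel t (x - y) * exp (- (s * (norm y)\<^sup>2)))) \<partial>mu \<partial>half_line) =
    (\<integral>\<^sup>+s. ennreal (s powr (a - 1) * ((1 + 4 * s * t) powr - (DIM('a) / 2) *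
      exp (- (s / (1 + 4 * s * t) * (norm x)\<^sup>2)))) \<partial>half_line)"
  proof (rule nn_integral_cong_half_line)
    fix s :: real assume s: "0 < s"
    have "(\<integral>\<^sup>+y. ennreal (s powr (a - 1) * (heat_kernel t (x - y) * exp (- (s * (norm y)\<^sup>2)))) \<partial>mu) =
      (\<integral>\<^sup>+y. ennreal (s powr (a - 1)) * ennreal (heat_kernel t (x - y) * exp (- (s * (norm y)\<^sup>2))) \<partial>mu)"
      by (simp add: ennreal_mult')
    also have "\<dots> = ennreal (s powr (a - 1)) * ennreal ((1 + 4 * s * t) powr - (DIM('a) / 2) *
      exp (- (s / (1 + 4 * s * t) * (norm x)\<^sup>2)))"
      by (subst nn_integral_cmult, measurable) (subst heat_kernel_gaussian[OF t s], rule refl)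
    finally show "(\<integral>\<^sup>+y. ennreal (s powr (a - 1) * (heat_kernel t (x - y) * exp (- (s * (norm y)\<^sup>2)))) \<partial>mu) =
      ennreal (s powr (a - 1) * ((1 + 4 * s * t) powr - (DIM('a) / 2) * exp (- (s / (1 + 4 * s * t) * (norm x)\<^sup>2))))"
      by (simp add: ennreal_mult')
  qed
  finally show ?thesis .
qed

text \<open>The factor that the weight \<open>|y|^(-n/2)\<close>, the same for all \<open>e\<close>,
  produces when \<open>a = n/4\<close>. The weight \<open>|y|^(-n/2-e)\<close> would give
  \<open>4^(-e) (Gamma(a - e/2) / Gamma(a + e/2))^2\<close>; the two agree to first order at
  \<open>e = 0\<close>, so they lead to the same derivative there.\<close>

definition pitt_const :: "real \<Rightarrow> real \<Rightarrow> real" where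
  "pitt_const a e = 4 powr - e * Gamma (a - e) / Gamma (a + e)"

lemma nn_integral_powr_scale:
  fixes e c :: real
  assumes [measurable]: "f \<in> borel_measurable borel" and c: "0 < c"
  shows "(\<integral>\<^sup>+t. ennreal (t powr (e - 1)) * f (c * t) \<partial>half_line) =
    ennreal (c powr - e) * (\<integral>\<^sup>+p. ennreal (p powr (e - 1)) * f p \<partial>half_line)"
proof -
  have "(\<integral>\<^sup>+p. ennreal (p powr (e - 1)) * f p \<partial>half_line) =
     ennreal c * (\<integral>\<^sup>+t. ennreal ((c * t) powr (e - 1)) * f (c * t) \<partial>half_line)"
    using c by (intro nn_integral_half_line_scale) auto
  also have "(\<integral>\<^sup>+t. ennreal ((c * t) powr (e - 1)) * f (c * t) \<partial>half_line) =
     (\<integral>\<^sup>+t. ennreal (c powr (e - 1)) * (ennreal (t powr (e - 1)) * f (c * t)) \<partial>half_line)"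
    using c by (intro nn_integral_cong_half_line) (simp add: powr_mult ennreal_mult' mult.assoc)
  also have "\<dots> = ennreal (c powr (e - 1)) * (\<integral>\<^sup>+t. ennreal (t powr (e - 1)) * f (c * t) \<partial>half_line)"
    by (rule nn_integral_cmult) measurable
  finally have "ennreal (c powr - e) * (\<integral>\<^sup>+p. ennreal (p powr (e - 1)) * f p \<partial>half_line) =
     (ennreal (c powr - e) * ennreal c * ennreal (c powr (e - 1))) * (\<integral>\<^sup>+t. ennreal (t powr (e - 1)) * f (c * t) \<partial>half_line)"
    by (simp only: mult.assoc)
  also have "ennreal (c powr - e) * ennreal c * ennreal (c powr (e - 1)) = ennreal (c powr - e * c powr 1 * c powr (e - 1))"
    using c by (simp add: ennreal_mult')
  also have "c powr - e * c powr 1 * c powr (e - 1) = 1"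
    using c by (simp only: powr_add[symmetric]) simp
  finally show ?thesis by simp
qed

text \<open>Integrating the heat kernel against \<open>t powr (e - 1)\<close> gives
  \<open>Gamma e\<close> times the Riesz potential of order \<open>2 * e\<close>. Homogeneity
  dictates the power on the right, so the content is the constant; \<open>e < a\<close> is the
  convergence condition of the integral for \<open>Gamma (a - e)\<close>.\<close>

lemma riesz_potential_inverse_power:
  fixes x :: "'a::euclidean_space"
  defines "a \<equiv> DIM('a) / 4"
  assumes e: "0 < e" "e < a" and x: "x \<noteq> 0"
  shows "(\<integral>\<^sup>+t. ennreal (t powr (e - 1)) * (\<integral>\<^sup>+y. ennreal (heat_kernel t (x - y) * norm y powr - (2 * a)) \<partial>mu) \<partial>half_line) =
    ennreal (Gamma e * pitt_const a e * norm x powr (2 * e - 2 * a))"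
proof -
  define X where "X = (norm x)\<^sup>2"
  have X: "X > 0" using x by (simp add: X_def)
  have a: "a > 0" using e by simp
  have n: "real DIM('a) / 2 = 2 * a" by (simp add: a_def)
  define h where "h p s = (1 + p) powr - (2 * a) * exp (- (s / (1 + p) * X))" for p s :: real
  have [measurable]: "(\<lambda>(p, s). h p s) \<in> borel_measurable (borel \<Otimes>\<^sub>M borel)"
    unfolding h_def by measurable
  have h0: "0 \<le> h p s" for p s by (simp add: h_def)
  have "(\<integral>\<^sup>+t. ennreal (t powr (e - 1)) * (\<integral>\<^sup>+y. ennreal (heat_kernel t (x - y) * norm y powr - (2 * a)) \<partial>mu) \<partial>half_line) =
    (\<integral>\<^sup>+t. ennreal (1 / Gamma a) * (\<integral>\<^sup>+s. ennreal (t powr (e - 1)) * ennreal (s powr (a - 1) * h (4 * s * t) s) \<partial>half_line) \<partial>half_line)"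
  proof (rule nn_integral_cong_half_line)
    fix t :: real assume t: "0 < t"
    show "ennreal (t powr (e - 1)) * (\<integral>\<^sup>+y. ennreal (heat_kernel t (x - y) * norm y powr - (2 * a)) \<partial>mu) =
      ennreal (1 / Gamma a) * (\<integral>\<^sup>+s. ennreal (t powr (e - 1)) * ennreal (s powr (a - 1) * h (4 * s * t) s) \<partial>half_line)"
      unfolding heat_flow_inverse_power[OF t a] n h_def X_def
      by (subst nn_integral_cmult, measurable) (simp only: mult_ac)
  qed
  also have "\<dots> = ennreal (1 / Gamma a) * (\<integral>\<^sup>+s. \<integral>\<^sup>+t. ennreal (t powr (e - 1)) * ennreal (s powr (a - 1) * h (4 * s * t) s) \<partial>half_line \<partial>half_line)"
    by (subst nn_integral_cmult, measurable) (subst half_half.Fubini', auto)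
  \<comment> \<open>The substitution \<open>p = 4 * s * t\<close> decouples the variables: for fixed
    \<open>p\<close> the exponent \<open>s / (1 + p) * X\<close> is linear in \<open>s\<close>, and
    the \<open>s\<close> integral becomes a Gamma integral.\<close>
  also have "(\<integral>\<^sup>+s. \<integral>\<^sup>+t. ennreal (t powr (e - 1)) * ennreal (s powr (a - 1) * h (4 * s * t) s) \<partial>half_line \<partial>half_line) =
    (\<integral>\<^sup>+s. \<integral>\<^sup>+p. ennreal ((4 * s) powr - e) * (ennreal (p powr (e - 1)) * ennreal (s powr (a - 1) * h p s)) \<partial>half_line \<partial>half_line)"
  proof (rule nn_integral_cong_half_line)
    fix s :: real assume s: "0 < s"
    show "(\<integral>\<^sup>+t. ennreal (t powr (e - 1)) * ennreal (s powr (a - 1) * h (4 * s * t) s) \<partial>half_line) =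
      (\<integral>\<^sup>+p. ennreal ((4 * s) powr - e) * (ennreal (p powr (e - 1)) * ennreal (s powr (a - 1) * h p s)) \<partial>half_line)"
      using s by (subst nn_integral_cmult, measurable)
        (subst nn_integral_powr_scale[where c="4 * s" and f="\<lambda>p. ennreal (s powr (a - 1) * h p s)"], auto)
  qed
  also have "\<dots> = (\<integral>\<^sup>+p. \<integral>\<^sup>+s. ennreal ((4 * s) powr - e) * (ennreal (p powr (e - 1)) * ennreal (s powr (a - 1) * h p s)) \<partial>half_line \<partial>half_line)"
    by (subst half_half.Fubini') auto
  also have "\<dots> = (\<integral>\<^sup>+p. ennreal (4 powr - e * Gamma (a - e) * X powr - (a - e)) * ennreal (p powr (e - 1) * (1 + p) powr - (a + e)) \<partial>half_line)"
  proof (rule nn_integral_cong_half_line)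
    fix p :: real assume p: "0 < p"
    have "(\<integral>\<^sup>+s. ennreal ((4 * s) powr - e) * (ennreal (p powr (e - 1)) * ennreal (s powr (a - 1) * h p s)) \<partial>half_line) =
      (\<integral>\<^sup>+s. ennreal (4 powr - e * p powr (e - 1) * (1 + p) powr - (2 * a)) * ennreal (s powr (a - e - 1) * exp (- (X / (1 + p) * s))) \<partial>half_line)"
    proof (rule nn_integral_cong_half_line)
      fix s :: real assume s: "0 < s"
      have "(4 * s) powr - e * s powr (a - 1) = 4 powr - e * s powr (a - e - 1)"
        using s by (simp add: powr_mult mult.assoc flip: powr_add) (simp add: algebra_simps)
      then have "(4 * s) powr - e * (p powr (e - 1) * (s powr (a - 1) * h p s)) =
        4 powr - e * p powr (e - 1) * (1 + p) powr - (2 * a) * (s powr (a - e - 1) * exp (- (X / (1 + p) * s)))"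
        unfolding h_def by (simp add: mult_ac)
      then show "ennreal ((4 * s) powr - e) * (ennreal (p powr (e - 1)) * ennreal (s powr (a - 1) * h p s)) =
        ennreal (4 powr - e * p powr (e - 1) * (1 + p) powr - (2 * a)) * ennreal (s powr (a - e - 1) * exp (- (X / (1 + p) * s)))"
        by (simp only: ennreal_mult'[symmetric] powr_ge_zero mult_nonneg_nonneg h0)
    qed
    also have "\<dots> = ennreal (4 powr - e * p powr (e - 1) * (1 + p) powr - (2 * a)) * ennreal (Gamma (a - e) * (X / (1 + p)) powr - (a - e))"
      using p X e by (subst nn_integral_cmult, measurable) (subst nn_integral_Gamma, auto)
    also have "\<dots> = ennreal (4 powr - e * Gamma (a - e) * X powr - (a - e)) * ennreal (p powr (e - 1) * (1 + p) powr - (a + e))"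
    proof -
      have "(1 + p) powr - (2 * a) * (X / (1 + p)) powr - (a - e) = X powr - (a - e) * ((1 + p) powr - (2 * a) * (1 + p) powr (a - e))"
      proof -
        have "(X / (1 + p)) powr - r = X powr - r * (1 + p) powr r" for r
          using p X by (simp add: powr_divide powr_minus divide_simps)
        from this[of "a - e"] show ?thesis by (simp only: mult_ac)
      qed
      \<comment> \<open>The heat flow contributes the exponent \<open>n / 2 = 2 * a\<close>, and the
        \<open>s\<close> integral gives back \<open>a - e\<close>. What remains is the beta integral
        with \<open>c = a\<close>.\<close>
      also have "(1 + p) powr - (2 * a) * (1 + p) powr (a - e) = (1 + p) powr - (a + e)"
        using p by (simp add: algebra_simps flip: powr_add)
      finally have "4 powr - e * p powr (e - 1) * (1 + p) powr - (2 * a) * (Gamma (a - e) * (X / (1 + p)) powr - (a - e)) =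
         4 powr - e * Gamma (a - e) * X powr - (a - e) * (p powr (e - 1) * (1 + p) powr - (a + e))"
        by (simp add: mult_ac)
      moreover have "0 \<le> Gamma (a - e)" using e by (simp add: Gamma_real_pos less_imp_le)
      ultimately show ?thesis
        by (simp only: ennreal_mult'[symmetric] powr_ge_zero mult_nonneg_nonneg)
    qed
    finally show "(\<integral>\<^sup>+s. ennreal ((4 * s) powr - e) * (ennreal (p powr (e - 1)) * ennreal (s powr (a - 1) * h p s)) \<partial>half_line) = \<dots>" .
  qed
  also have "\<dots> = ennreal (4 powr - e * Gamma (a - e) * X powr - (a - e)) * ennreal (Gamma e * Gamma a / Gamma (a + e))"
    using e a by (subst nn_integral_cmult, measurable) (subst nn_integral_beta_prime, auto)
  also have "ennreal (1 / Gamma a) * \<dots> = ennreal (Gamma e * pitt_const a e * norm x powr (2 * e - 2 * a))"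
  proof -
    have g: "Gamma a > 0" "Gamma (a - e) > 0" using e a by (auto intro!: Gamma_real_pos)
    have "X powr - (a - e) = norm x powr (2 * e - 2 * a)"
      using x by (simp add: X_def powr_powr algebra_simps flip: powr_numeral)
    then have "1 / Gamma a * (4 powr - e * Gamma (a - e) * X powr - (a - e) * (Gamma e * Gamma a / Gamma (a + e))) =
      Gamma e * pitt_const a e * norm x powr (2 * e - 2 * a)"
      using g by (simp add: pitt_const_def field_simps)
    then show ?thesis
      using g by (simp only: ennreal_mult'[symmetric] powr_ge_zero mult_nonneg_nonneg less_imp_le divide_nonneg_nonneg zero_le_one)
  qed
  finally show ?thesis .
qed

text \<open>After mixing Gaussians, the space integral contributes \<open>s^(-n/2)\<close> and
  leaves \<open>s^(b - n/2 - 1) exp(-s)\<close>; the threshold for \<open>b\<close> is that of the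
  Gamma integral.\<close>

lemma nn_integral_inverse_power_finite:
  assumes b: "DIM('a::euclidean_space) / 2 < b"
  shows "(\<integral>\<^sup>+x. ennreal ((1 + (norm (x::'a))\<^sup>2) powr - b) \<partial>mu) < \<infinity>"
proof -
  have b0: "b > 0" using b by (meson divide_nonneg_nonneg le_less_trans of_nat_0_le_iff zero_le_numeral)
  have pos: "0 < 1 + (norm x)\<^sup>2" for x :: 'a by (simp add: add_pos_nonneg)
  have "(\<integral>\<^sup>+x. ennreal ((1 + (norm (x::'a))\<^sup>2) powr - b) \<partial>mu) =
    ennreal (1 / Gamma b) * (\<integral>\<^sup>+x. \<integral>\<^sup>+s. ennreal (s powr (b - 1) * exp (- ((1 + (norm (x::'a))\<^sup>2) * s))) \<partial>half_line \<partial>mu)"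
    by (subst nn_integral_cmult[symmetric], measurable) (simp only: powr_neg_eq_nn_integral[OF b0 pos])
  also have "(\<integral>\<^sup>+x. \<integral>\<^sup>+s. ennreal (s powr (b - 1) * exp (- ((1 + (norm (x::'a))\<^sup>2) * s))) \<partial>half_line \<partial>mu) =
    (\<integral>\<^sup>+s. \<integral>\<^sup>+x. ennreal (s powr (b - 1) * exp (- ((1 + (norm (x::'a))\<^sup>2) * s))) \<partial>mu \<partial>half_line)"
    by (subst half_mu.Fubini') auto
  also have "\<dots> = (\<integral>\<^sup>+s. ennreal (2 powr - (DIM('a) / 2)) * ennreal (s powr (b - DIM('a) / 2 - 1) * exp (- (1 * s))) \<partial>half_line)"
  proof (rule nn_integral_cong_half_line)
    fix s :: real assume s: "0 < s"
    have "(\<integral>\<^sup>+x. ennreal (s powr (b - 1) * exp (- ((1 + (norm (x::'a))\<^sup>2) * s))) \<partial>mu) =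
      (\<integral>\<^sup>+x. ennreal (s powr (b - 1) * exp (- s)) * ennreal (exp (- (s * (norm (x::'a))\<^sup>2))) \<partial>mu)"
      by (intro nn_integral_cong) (simp add: ennreal_mult'[symmetric] mult_exp_exp mult.assoc algebra_simps)
    also have "\<dots> = ennreal (s powr (b - 1) * exp (- s)) * ennreal ((2 * s) powr - (DIM('a) / 2))"
      using s by (subst nn_integral_cmult, measurable) (subst nn_integral_gaussian_mu, auto)
    also have "\<dots> = ennreal (2 powr - (DIM('a) / 2)) * ennreal (s powr (b - DIM('a) / 2 - 1) * exp (- (1 * s)))"
    proof -
      have "s powr (b - 1) * s powr - (DIM('a) / 2) = s powr (b - DIM('a) / 2 - 1)"
        using s by (simp add: algebra_simps flip: powr_add)
      then have "s powr (b - 1) * exp (- s) * (2 * s) powr - (DIM('a) / 2) =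
        2 powr - (DIM('a) / 2) * (s powr (b - DIM('a) / 2 - 1) * exp (- (1 * s)))"
        using s by (simp add: powr_mult mult_ac)
      then show ?thesis
        by (simp only: ennreal_mult'[symmetric] powr_ge_zero mult_nonneg_nonneg exp_ge_zero)
    qed
    finally show "(\<integral>\<^sup>+x. ennreal (s powr (b - 1) * exp (- ((1 + (norm (x::'a))\<^sup>2) * s))) \<partial>mu) = \<dots>" .
  qed
  also have "\<dots> = ennreal (2 powr - (DIM('a) / 2)) * ennreal (Gamma (b - DIM('a) / 2) * 1 powr - (b - DIM('a) / 2))"
    using b by (subst nn_integral_cmult, measurable) (subst nn_integral_Gamma, auto)
  finally show ?thesis by (simp add: ennreal_mult_less_top)
qed

text \<open>Local integrability of \<open>1 / |x|\<close>, with a Gaussian cutting off infinity: the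
  mixing integral is \<open>s^(-1/2) (1 + s)^(-n/2)\<close>, finite for \<open>n > 1\<close>. This
  provides the majorant near the origin for logarithms and small powers.\<close>

lemma nn_integral_inverse_norm_gaussian_finite:
  assumes n: "2 \<le> DIM('a::euclidean_space)"
  shows "(\<integral>\<^sup>+x. ennreal (norm (x::'a) powr - 1 * exp (- (norm (x::'a))\<^sup>2)) \<partial>mu) < \<infinity>"
proof -
  have "(\<integral>\<^sup>+x. ennreal (norm (x::'a) powr - 1 * exp (- (norm (x::'a))\<^sup>2)) \<partial>mu) =
    (\<integral>\<^sup>+x. ennreal (1 / Gamma (1 / 2)) * (\<integral>\<^sup>+s. ennreal (s powr (1 / 2 - 1) * exp (- ((1 + s) * (norm (x::'a))\<^sup>2))) \<partial>half_line) \<partial>mu)"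
  proof (intro nn_integral_cong_AE eventually_mono[OF AE_mu_neq[of 0]])
    fix x :: 'a assume x: "x \<noteq> 0"
    have "ennreal (norm x powr - 1 * exp (- (norm x)\<^sup>2)) =
      ennreal (1 / Gamma (1 / 2)) * (ennreal (exp (- (norm x)\<^sup>2)) * (\<integral>\<^sup>+s. ennreal (s powr (1 / 2 - 1) * exp (- (s * (norm x)\<^sup>2))) \<partial>half_line))"
      using norm_powr_eq_nn_integral[of "1/2" x, symmetric] x
      by (simp add: ennreal_mult'[symmetric] mult.left_commute[of "ennreal (1 / Gamma (1 / 2))"])
    also have "ennreal (exp (- (norm x)\<^sup>2)) * (\<integral>\<^sup>+s. ennreal (s powr (1 / 2 - 1) * exp (- (s * (norm x)\<^sup>2))) \<partial>half_line) =
      (\<integral>\<^sup>+s. ennreal (s powr (1 / 2 - 1) * exp (- ((1 + s) * (norm x)\<^sup>2))) \<partial>half_line)"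
    proof -
      have "exp (- (norm x)\<^sup>2) * (s powr (1 / 2 - 1) * exp (- (s * (norm x)\<^sup>2))) =
          s powr (1 / 2 - 1) * exp (- ((1 + s) * (norm x)\<^sup>2))" for s
      proof -
        have "exp (- ((1 + s) * (norm x)\<^sup>2)) = exp (- (norm x)\<^sup>2) * exp (- (s * (norm x)\<^sup>2))"
          unfolding mult_exp_exp by (simp add: distrib_right)
        then show ?thesis by (simp only: mult_ac)
      qed
      then show ?thesis
        by (subst nn_integral_cmult[symmetric], measurable) (simp only: ennreal_mult'[symmetric] exp_ge_zero)
    qed
    finally show "ennreal (norm x powr - 1 * exp (- (norm x)\<^sup>2)) = ennreal (1 / Gamma (1 / 2)) * \<dots>" .
  qed
  also have "\<dots> = ennreal (1 / Gamma (1 / 2)) * (\<integral>\<^sup>+s. \<integral>\<^sup>+x. ennreal (s powr (1 / 2 - 1) * exp (- ((1 + s) * (norm (x::'a))\<^sup>2))) \<partial>mu \<partial>half_line)"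
    by (subst nn_integral_cmult, measurable) (subst half_mu.Fubini', auto)
  also have "(\<integral>\<^sup>+s. \<integral>\<^sup>+x. ennreal (s powr (1 / 2 - 1) * exp (- ((1 + s) * (norm (x::'a))\<^sup>2))) \<partial>mu \<partial>half_line) =
    (\<integral>\<^sup>+s. ennreal (2 powr - (DIM('a) / 2)) * ennreal (s powr (1 / 2 - 1) * (1 + s) powr - ((DIM('a) / 2 - 1 / 2) + 1 / 2)) \<partial>half_line)"
  proof (rule nn_integral_cong_half_line)
    fix s :: real assume s: "0 < s"
    have "(\<integral>\<^sup>+x. ennreal (s powr (1 / 2 - 1) * exp (- ((1 + s) * (norm (x::'a))\<^sup>2))) \<partial>mu) =
      ennreal (s powr (1 / 2 - 1)) * ennreal ((2 * (1 + s)) powr - (DIM('a) / 2))"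
      using s by (simp only: ennreal_mult' powr_ge_zero)
        (subst nn_integral_cmult, measurable, subst nn_integral_gaussian_mu, auto)
    also have "\<dots> = ennreal (2 powr - (DIM('a) / 2)) * ennreal (s powr (1 / 2 - 1) * (1 + s) powr - ((DIM('a) / 2 - 1 / 2) + 1 / 2))"
    proof -
      have "(2 * (1 + s)) powr - (DIM('a) / 2) = 2 powr - (DIM('a) / 2) * (1 + s) powr - (DIM('a) / 2)"
        by (rule powr_mult)
      then show ?thesis
        by (simp add: ennreal_mult'[symmetric] mult_ac del: distrib_left_numeral)
    qed
    finally show "(\<integral>\<^sup>+x. ennreal (s powr (1 / 2 - 1) * exp (- ((1 + s) * (norm (x::'a))\<^sup>2))) \<partial>mu) = \<dots>" .
  qed
  also have "\<dots> = ennreal (2 powr - (DIM('a) / 2)) * ennreal (Gamma (1 / 2) * Gamma (DIM('a) / 2 - 1 / 2) / Gamma ((DIM('a) / 2 - 1 / 2) + 1 / 2))"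
    using n by (subst nn_integral_cmult, measurable) (subst nn_integral_beta_prime, auto)
  finally show ?thesis by (simp add: ennreal_mult_less_top)
qed

section \<open>The two sided quaternion Fourier transform\<close>

lemma inner_quat_mult: "(p * q) \<bullet> (p * q) = (p \<bullet> p) * (q \<bullet> (q :: quat))"
  unfolding inner_quat_def times_quat_def quat.sel by algebra

lemma norm_quat_mult: "norm (p * q) = norm p * norm (q :: quat)"
  by (simp add: norm_quat_def inner_quat_mult real_sqrt_mult)

lemma norm_qcnj [simp]: "norm (qcnj q) = norm q"
  by (simp add: norm_quat_def inner_quat_def qcnj_def)

lemma qcnj_diff: "qcnj (p - q) = qcnj p - qcnj q"
  by (simp add: qcnj_def minus_quat_def)

lemma bounded_linear_qcnj: "bounded_linear qcnj"
proof (rule bounded_linear_intro[where K=1])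
  show "qcnj (p + q) = qcnj p + qcnj q" "qcnj (r *\<^sub>R p) = r *\<^sub>R qcnj p" for p q r
    by (simp_all add: qcnj_def plus_quat_def scaleR_quat_def)
qed simp

lemma measurable_qcnj [measurable]: "qcnj \<in> borel_measurable borel"
  by (intro borel_measurable_continuous_onI linear_continuous_on bounded_linear_qcnj)

text \<open>A square root of \<open>- 1\<close> spans together with \<open>1\<close> a copy of the
  complex numbers. The embedding \<open>\<phi>\<close> is continuous and multiplicative, so it
  carries the exponential series, and with it Euler's formula, into the quaternions.\<close>

lemma exp_scaleR_imaginary:
  fixes u :: quat
  assumes u: "u * u = - 1"
  shows "exp (r *\<^sub>R u) = cos r *\<^sub>R 1 + sin r *\<^sub>R u"
proof -
  define \<phi> where "\<phi> z = Re z *\<^sub>R 1 + Im z *\<^sub>R u" for z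
  have bl: "bounded_linear \<phi>"
    unfolding \<phi>_def
    by (intro bounded_linear_add bounded_linear_scaleR_const bounded_linear_Re bounded_linear_Im)
  have mult: "\<phi> (y * z) = \<phi> y * \<phi> z" for y z
    using u by (simp add: \<phi>_def algebra_simps)
  have pow: "\<phi> (z ^ n) = \<phi> z ^ n" for z n
    by (induction n) (simp_all add: mult, simp add: \<phi>_def)
  have "(\<lambda>n. \<phi> (complex_of_real r * \<i>) ^ n /\<^sub>R fact n) sums exp (\<phi> (complex_of_real r * \<i>))"
    by (rule exp_converges)
  moreover have "(\<lambda>n. \<phi> ((complex_of_real r * \<i>) ^ n /\<^sub>R fact n)) sums \<phi> (exp (complex_of_real r * \<i>))"
    by (intro bounded_linear.sums[OF bl] exp_converges)
  ultimately have "exp (\<phi> (complex_of_real r * \<i>)) = \<phi> (exp (complex_of_real r * \<i>))"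
    by (simp add: pow linear_scale[OF bounded_linear.linear[OF bl]] sums_unique2)
  then show ?thesis
    by (simp add: \<phi>_def mult.commute[of _ \<i>] flip: cis_conv_exp)
qed

text \<open>The integrand of \<open>qwft\<close> as an operation on a single value \<open>q\<close>.
  The phases sit on different sides and cannot be merged, but for fixed \<open>w\<close> and
  \<open>y\<close> this is a real-linear isometry of the quaternions.\<close>

definition qrot :: "'a::euclidean_space \<times> 'a \<Rightarrow> 'a \<times> 'a \<Rightarrow> quat \<Rightarrow> quat" where
  "qrot w y q = exp (- (fst y \<bullet> fst w) *\<^sub>R quat_i) * q * exp (- (snd y \<bullet> snd w) *\<^sub>R quat_j)"

definition qft :: "('a::euclidean_space \<times> 'a \<Rightarrow> quat) \<Rightarrow> 'a \<times> 'a \<Rightarrow> quat" where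
  "qft h w = (\<integral>y. qrot w y (h y) \<partial>mu)"

lemma qwft_eq_qft: "qwft g f x w = qft (\<lambda>y. f y * qcnj (g (y - x))) w"
  by (simp add: qwft_def qft_def qrot_def mult.assoc)

lemma qrot_eq: "qrot w y q =
   (cos (fst y \<bullet> fst w) *\<^sub>R 1 - sin (fst y \<bullet> fst w) *\<^sub>R quat_i) * q *
   (cos (snd y \<bullet> snd w) *\<^sub>R 1 - sin (snd y \<bullet> snd w) *\<^sub>R quat_j)"
  unfolding qrot_def exp_scaleR_imaginary[OF quat_units(1)] exp_scaleR_imaginary[OF quat_units(2)] by simp

lemma norm_qrot [simp]: "norm (qrot w y q) = norm q"
proof -
  have "norm (exp (r *\<^sub>R quat_i)) = 1" "norm (exp (r *\<^sub>R quat_j)) = 1" for r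
    unfolding exp_scaleR_imaginary[OF quat_units(1)] exp_scaleR_imaginary[OF quat_units(2)]
    by (simp_all add: norm_quat_def inner_quat_def quat_i_def
        quat_j_def one_quat_def plus_quat_def scaleR_quat_def flip: power2_eq_square)
  from this(1)[of "- (fst y \<bullet> fst w)"] this(2)[of "- (snd y \<bullet> snd w)"] show ?thesis
    by (simp only: qrot_def norm_quat_mult)
qed

lemma measurable_qrot [measurable (raw)]:
  assumes "f \<in> borel_measurable M" "g \<in> borel_measurable M" "h \<in> borel_measurable M"
  shows "(\<lambda>x. qrot (f x) (g x) (h x)) \<in> borel_measurable M"
proof -
  have "f \<in> M \<rightarrow>\<^sub>M borel \<Otimes>\<^sub>M borel" "g \<in> M \<rightarrow>\<^sub>M borel \<Otimes>\<^sub>M borel"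
    using assms by (simp_all add: borel_prod)
  note [measurable] = this assms(3)
  show ?thesis unfolding qrot_eq by measurable
qed

text \<open>The real part of a quaternion product is cyclic, so only the differences of the phases enter.\<close>

lemma inner_qrot:
  "qrot w y p \<bullet> qrot w y' q =
     cos (fst (y - y') \<bullet> fst w) * cos (snd (y - y') \<bullet> snd w) * (p \<bullet> q)
   - sin (fst (y - y') \<bullet> fst w) * cos (snd (y - y') \<bullet> snd w) * ((quat_i * p) \<bullet> q)
   - cos (fst (y - y') \<bullet> fst w) * sin (snd (y - y') \<bullet> snd w) * ((p * quat_j) \<bullet> q)
   + sin (fst (y - y') \<bullet> fst w) * sin (snd (y - y') \<bullet> snd w) * ((quat_i * p * quat_j) \<bullet> q)"
proof -
  have "((a *\<^sub>R 1 - b *\<^sub>R quat_i) * p * (c *\<^sub>R 1 - d *\<^sub>R quat_j)) \<bullet>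
        ((a' *\<^sub>R 1 - b' *\<^sub>R quat_i) * q * (c' *\<^sub>R 1 - d' *\<^sub>R quat_j)) =
      (a * a' + b * b') * (c * c' + d * d') * (p \<bullet> q)
    - (b * a' - a * b') * (c * c' + d * d') * ((quat_i * p) \<bullet> q)
    - (a * a' + b * b') * (d * c' - c * d') * ((p * quat_j) \<bullet> q)
    + (b * a' - a * b') * (d * c' - c * d') * ((quat_i * p * quat_j) \<bullet> q)" for a b c d a' b' c' d'
    unfolding quat_i_def quat_j_def one_quat_def scaleR_quat_def minus_quat_def times_quat_def
      inner_quat_def quat.sel by algebra
  then show ?thesis
    unfolding qrot_eq fst_diff snd_diff inner_diff_left cos_diff sin_diff by (simp only:)
qed

text \<open>The products of cosines and sines recombine into waves with the frequencies
  \<open>z1 = (s, t)\<close> and \<open>z2 = (s, - t)\<close>. Sines integrate to 0 against the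
  Gaussian. The cosines of \<open>z1\<close> and \<open>z2\<close> give the same kernel, since the
  frequencies have equal length, and the term \<open>?C\<close> enters them with opposite signs and
  cancels. Only the expression known from the commutative transform survives.\<close>

lemma gaussian_inner_qrot:
  fixes y y' :: "'a::euclidean_space \<times> 'a"
  assumes t: "0 < t"
  shows "has_bochner_integral mu (\<lambda>w. exp (- (t * (norm w)\<^sup>2)) * (qrot w y p \<bullet> qrot w y' q))
    (heat_kernel t (y - y') * (p \<bullet> q))"
proof -
  define z1 where "z1 = y - y'"
  define z2 where "z2 = (fst (y - y'), - snd (y - y'))"
  let ?A = "(quat_i * p) \<bullet> q" and ?B = "(p * quat_j) \<bullet> q" and ?C = "(quat_i * p * quat_j) \<bullet> q"
  let ?e = "\<lambda>w::'a \<times> 'a. exp (- (t * (norm w)\<^sup>2))"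
  have k2: "heat_kernel t z2 = heat_kernel t z1"
    by (simp add: heat_kernel_def z1_def z2_def norm_prod_def norm_minus_commute)
  have c: "has_bochner_integral mu (\<lambda>w. ?e w * cos (z \<bullet> w)) (heat_kernel t z)" for z
    using gaussian_cos_mu[OF t, of z] by (simp add: heat_kernel_def)
  note s = gaussian_sin_mu[OF t]
  have "has_bochner_integral mu
    (\<lambda>w. (?e w * cos (z1 \<bullet> w)) * ((p \<bullet> q - ?C) / 2) + (?e w * cos (z2 \<bullet> w)) * ((p \<bullet> q + ?C) / 2)
       + ((?e w * sin (z1 \<bullet> w)) * (- (?A + ?B) / 2) + (?e w * sin (z2 \<bullet> w)) * ((?B - ?A) / 2)))
    (heat_kernel t z1 * ((p \<bullet> q - ?C) / 2) + heat_kernel t z2 * ((p \<bullet> q + ?C) / 2)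
       + (0 * (- (?A + ?B) / 2) + 0 * ((?B - ?A) / 2)))"
    by (intro has_bochner_integral_add has_bochner_integral_mult_left c s)
  also have "heat_kernel t z1 * ((p \<bullet> q - ?C) / 2) + heat_kernel t z2 * ((p \<bullet> q + ?C) / 2)
       + (0 * (- (?A + ?B) / 2) + 0 * ((?B - ?A) / 2)) = heat_kernel t (y - y') * (p \<bullet> q)"
    unfolding k2 by (simp add: z1_def field_simps)
  also have "(\<lambda>w. (?e w * cos (z1 \<bullet> w)) * ((p \<bullet> q - ?C) / 2) + (?e w * cos (z2 \<bullet> w)) * ((p \<bullet> q + ?C) / 2)
       + ((?e w * sin (z1 \<bullet> w)) * (- (?A + ?B) / 2) + (?e w * sin (z2 \<bullet> w)) * ((?B - ?A) / 2))) =
     (\<lambda>w. ?e w * (qrot w y p \<bullet> qrot w y' q))"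
  proof
    fix w
    have w: "z1 \<bullet> w = fst (y - y') \<bullet> fst w + snd (y - y') \<bullet> snd w"
      "z2 \<bullet> w = fst (y - y') \<bullet> fst w - snd (y - y') \<bullet> snd w"
      by (simp_all only: z1_def z2_def inner_prod_def fst_conv snd_conv inner_minus_left add_uminus_conv_diff)
    show "(?e w * cos (z1 \<bullet> w)) * ((p \<bullet> q - ?C) / 2) + (?e w * cos (z2 \<bullet> w)) * ((p \<bullet> q + ?C) / 2)
       + ((?e w * sin (z1 \<bullet> w)) * (- (?A + ?B) / 2) + (?e w * sin (z2 \<bullet> w)) * ((?B - ?A) / 2)) =
      ?e w * (qrot w y p \<bullet> qrot w y' q)"
      unfolding inner_qrot w cos_add sin_add cos_diff sin_diff by (simp add: field_simps)
  qed
  finally show ?thesis .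
qed

lemma integrable_pair_mult:
  fixes f :: "'a \<Rightarrow> real" and g :: "'b \<Rightarrow> real"
  assumes "sigma_finite_measure M" "sigma_finite_measure N"
    and f: "integrable M f" and g: "integrable N g"
  shows "integrable (M \<Otimes>\<^sub>M N) (\<lambda>(x, y). f x * g y)"
proof -
  interpret M: sigma_finite_measure M by fact
  interpret N: sigma_finite_measure N by fact
  interpret pair_sigma_finite M N ..
  note [measurable] = borel_measurable_integrable[OF f] borel_measurable_integrable[OF g]
  show ?thesis
    by (rule Fubini_integrable) (auto simp: abs_mult f g integrable_abs)
qed

lemma integrable_qrot:
  assumes "integrable mu h"
  shows "integrable mu (\<lambda>y. qrot w y (h y))"
  by (rule Bochner_Integration.integrable_bound[OF assms])
    (use borel_measurable_integrable[OF assms] in \<open>auto intro!: measurable_qrot\<close>)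

lemma measurable_qft:
  assumes "integrable mu h"
  shows "qft h \<in> borel_measurable borel"
proof -
  have [measurable]: "h \<in> borel_measurable borel" using borel_measurable_integrable[OF assms] by simp
  show ?thesis
    unfolding qft_def[abs_def] by (rule mu.borel_measurable_lebesgue_integral) measurable
qed

text \<open>The square of the transform is a double integral over \<open>y\<close> and
  \<open>y'\<close>. The Gaussian makes the triple integral absolutely convergent, with majorant
  \<open>exp (- t |w|^2) |h y| |h y'|\<close>, and so allows the \<open>w\<close> integral to be
  done first.\<close>

lemma gaussian_qft:
  fixes h :: "'a::euclidean_space \<times> 'a \<Rightarrow> quat"
  assumes t: "0 < t" and h: "integrable mu h"
  shows "has_bochner_integral mu (\<lambda>w. exp (- (t * (norm w)\<^sup>2)) * (norm (qft h w))\<^sup>2)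
    (\<integral>(y, y'). heat_kernel t (y - y') * (h y \<bullet> h y') \<partial>(mu \<Otimes>\<^sub>M mu))"
proof -
  have [measurable]: "h \<in> borel_measurable borel" using borel_measurable_integrable[OF h] by simp
  let ?P = "mu \<Otimes>\<^sub>M mu :: (('a \<times> 'a) \<times> ('a \<times> 'a)) measure"
  let ?e = "\<lambda>w::'a \<times> 'a. exp (- (t * (norm w)\<^sup>2))"
  have P: "sigma_finite_measure ?P" ..
  interpret wP: pair_sigma_finite mu ?P ..
  have hn: "integrable mu (\<lambda>y. norm (h y))" using h by (rule integrable_norm)
  have hh: "integrable ?P (\<lambda>(y, y'). norm (h y) * norm (h y'))"
    by (intro integrable_pair_mult hn mu.sigma_finite_measure_axioms)
  have big: "integrable (mu \<Otimes>\<^sub>M ?P) (\<lambda>(w, z). ?e w * (case z of (y, y') \<Rightarrow> norm (h y) * norm (h y')))"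
    using gaussian_mu[OF t, where 'a="'a \<times> 'a"]
    by (intro integrable_pair_mult hh mu.sigma_finite_measure_axioms P)
      (simp add: has_bochner_integral_iff)
  have inner_bound: "\<bar>qrot w y (h y) \<bullet> qrot w y' (h y')\<bar> \<le> norm (h y) * norm (h y')" for w y y'
    using Cauchy_Schwarz_ineq2[of "qrot w y (h y)" "qrot w y' (h y')"] by simp
  have 1: "(norm (qft h w))\<^sup>2 = (\<integral>(y, y'). qrot w y (h y) \<bullet> qrot w y' (h y') \<partial>?P)" for w
  proof -
    note hw = integrable_qrot[OF h, of w]
    have "(norm (qft h w))\<^sup>2 = (\<integral>y. qrot w y (h y) \<partial>mu) \<bullet> qft h w"
      by (simp add: power2_norm_eq_inner qft_def)
    also have "\<dots> = (\<integral>y. qrot w y (h y) \<bullet> (\<integral>y'. qrot w y' (h y') \<partial>mu) \<partial>mu)"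
      using hw by (simp add: qft_def)
    also have "\<dots> = (\<integral>y. \<integral>y'. qrot w y (h y) \<bullet> qrot w y' (h y') \<partial>mu \<partial>mu)"
      using hw by (simp only: integral_inner_right)
    also have "\<dots> = (\<integral>(y, y'). qrot w y (h y) \<bullet> qrot w y' (h y') \<partial>?P)"
    proof (subst mu2.integral_fst)
      show "integrable ?P (\<lambda>(y, y'). qrot w y (h y) \<bullet> qrot w y' (h y'))"
        by (rule Bochner_Integration.integrable_bound[OF hh]) (auto intro!: inner_bound)
    qed simp
    finally show ?thesis .
  qed
  let ?F = "\<lambda>w z. ?e w * (case z of (y, y') \<Rightarrow> qrot w y (h y) \<bullet> qrot w y' (h y'))"
  have F: "integrable (mu \<Otimes>\<^sub>M ?P) (\<lambda>(w, z). ?F w z)"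
  proof (rule Bochner_Integration.integrable_bound[OF big])
    show "(\<lambda>(w, z). ?F w z) \<in> borel_measurable (mu \<Otimes>\<^sub>M ?P)" by measurable
    show "AE x in mu \<Otimes>\<^sub>M ?P. norm (case x of (w, z) \<Rightarrow> ?F w z) \<le>
       norm (case x of (w, z) \<Rightarrow> ?e w * (case z of (y, y') \<Rightarrow> norm (h y) * norm (h y')))"
      by (intro AE_I2) (auto simp: abs_mult intro!: mult_left_mono inner_bound)
  qed
  have 2: "(\<lambda>w. ?e w * (norm (qft h w))\<^sup>2) = (\<lambda>w. \<integral>z. ?F w z \<partial>?P)"
    unfolding 1 by (rule ext) (simp only: integral_mult_right_zero)
  have "integrable mu (\<lambda>w. \<integral>z. ?F w z \<partial>?P)"
    by (rule wP.integrable_fst[OF F])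
  moreover have "(\<integral>w. \<integral>z. ?F w z \<partial>?P \<partial>mu) = (\<integral>z. \<integral>w. ?F w z \<partial>mu \<partial>?P)"
    by (rule wP.Fubini_integral[OF F, symmetric])
  moreover have "(\<integral>w. ?F w z \<partial>mu) = (case z of (y, y') \<Rightarrow> heat_kernel t (y - y') * (h y \<bullet> h y'))" for z
    using gaussian_inner_qrot[OF t, of "fst z" "h (fst z)" "snd z" "h (snd z)"]
    by (simp add: has_bochner_integral_iff split_beta)
  ultimately show ?thesis
    unfolding 2 has_bochner_integral_iff by simp
qed

section \<open>Plancherel and logarithmic decay\<close>

lemma has_bochner_integral_convolution:
  fixes k f :: "'a::euclidean_space \<Rightarrow> real"
  assumes k[measurable]: "k \<in> borel_measurable borel" and k0: "\<And>z. 0 \<le> k z"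
    and K: "(\<integral>\<^sup>+z. ennreal (k z) \<partial>mu) = ennreal K" "0 \<le> K" and f: "integrable mu f"
  shows "has_bochner_integral (mu \<Otimes>\<^sub>M mu) (\<lambda>(y, y'). k (y - y') * f y) (K * (\<integral>y. f y \<partial>mu))"
proof -
  have [measurable]: "f \<in> borel_measurable borel" using borel_measurable_integrable[OF f] by simp
  have kk: "has_bochner_integral mu (\<lambda>y'. k (y - y')) K" for y
  proof (rule has_bochner_integral_nn_integral)
    show "(\<integral>\<^sup>+y'. ennreal (k (y - y')) \<partial>mu) = ennreal K"
      using nn_integral_mu_reflect[of "\<lambda>z. ennreal (k z)" y] K by simp
  qed (auto simp: k0 K)
  have inner: "has_bochner_integral mu (\<lambda>y'. k (y - y') * c) (K * c)" for y c
    by (rule has_bochner_integral_mult_left) (rule kk)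
  have "integrable (mu \<Otimes>\<^sub>M mu) (\<lambda>(y, y'). k (y - y') * f y)"
  proof (rule mu2.Fubini_integrable)
    have "(\<lambda>y. \<integral>y'. norm (case (y, y') of (y, y') \<Rightarrow> k (y - y') * f y) \<partial>mu) = (\<lambda>y. K * \<bar>f y\<bar>)"
      using kk by (simp add: has_bochner_integral_iff abs_mult k0)
    then show "integrable mu (\<lambda>y. \<integral>y'. norm (case (y, y') of (y, y') \<Rightarrow> k (y - y') * f y) \<partial>mu)"
      using f by simp
  qed (use inner in \<open>auto simp: has_bochner_integral_iff\<close>)
  moreover from this have "(\<integral>(y, y'). k (y - y') * f y \<partial>(mu \<Otimes>\<^sub>M mu)) = (\<integral>y. \<integral>y'. k (y - y') * f y \<partial>mu \<partial>mu)"
    by (rule mu2.integral_fst[symmetric])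
  moreover have "(\<integral>y'. k (y - y') \<partial>mu) = K" for y
    using kk by (simp only: has_bochner_integral_iff)
  ultimately show ?thesis
    by (simp add: has_bochner_integral_iff)
qed

lemma has_bochner_integral_convolution':
  fixes k f :: "'a::euclidean_space \<Rightarrow> real"
  assumes "k \<in> borel_measurable borel" "\<And>z. 0 \<le> k z" and even: "\<And>z. k (- z) = k z"
    and "(\<integral>\<^sup>+z. ennreal (k z) \<partial>mu) = ennreal K" "0 \<le> K" and f: "integrable mu f"
  shows "has_bochner_integral (mu \<Otimes>\<^sub>M mu) (\<lambda>(y, y'). k (y - y') * f y') (K * (\<integral>y. f y \<partial>mu))"
proof -
  have 1: "(\<lambda>(y, y'). k (y - y') * f y') = (\<lambda>(y, y'). (\<lambda>(a, b). k (a - b) * f a) (y', y))"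
    using even by (force simp: fun_eq_iff intro: arg_cong2[where f="(*)"] dest: spec[of _ "_ - _"])
  have 2: "has_bochner_integral (mu \<Otimes>\<^sub>M mu) (\<lambda>(a, b). k (a - b) * f a) (K * (\<integral>y. f y \<partial>mu))"
    using assms by (intro has_bochner_integral_convolution)
  have 3: "integrable (mu \<Otimes>\<^sub>M mu) (\<lambda>(y, y'). (\<lambda>(a, b). k (a - b) * f a) (y', y))"
    using 2 by (intro mu2.integrable_product_swap) (simp only: has_bochner_integral_iff)
  have 4: "(\<integral>(y, y'). (\<lambda>(a, b). k (a - b) * f a) (y', y) \<partial>(mu \<Otimes>\<^sub>M mu)) =
      (\<integral>(a, b). k (a - b) * f a \<partial>(mu \<Otimes>\<^sub>M mu))"
    using 2 by (intro mu2.integral_product_swap borel_measurable_has_bochner_integral)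
  show ?thesis
    unfolding 1 using 2 3 4 by (simp only: has_bochner_integral_iff)
qed

lemma heat_kernel_minus [simp]: "heat_kernel t (- z) = heat_kernel t z"
  by (simp add: heat_kernel_def)

lemma measurable_heat_kernel' [measurable]: "heat_kernel t \<in> borel_measurable borel"
  unfolding heat_kernel_def by measurable

text \<open>In terms of \<open>r = |z| / sqrt t\<close>, the factor \<open>exp (- r^2 / 4)\<close>
  is split into two halves: one absorbs \<open>r\<close> at the cost of a factor 2, the other is the
  Gaussian at time \<open>2 * t\<close>. The factor \<open>2^(n/2)\<close> compares the
  normalisations at the two times.\<close>

lemma norm_mult_heat_kernel_le:
  fixes z :: "'a::euclidean_space"
  assumes t: "0 < t"
  shows "norm z * heat_kernel t z \<le> (2 * 2 powr (DIM('a) / 2) * sqrt t) * heat_kernel (2 * t) z"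
proof -
  define r where "r = norm z / sqrt t"
  have r: "norm z = r * sqrt t" "(norm z)\<^sup>2 / t = r\<^sup>2"
    using t by (simp_all add: r_def power_divide)
  have e: "(norm z)\<^sup>2 / (4 * t) = r\<^sup>2 / 8 + r\<^sup>2 / 8" "(norm z)\<^sup>2 / (4 * (2 * t)) = r\<^sup>2 / 8"
    unfolding r(2)[symmetric] by (simp_all add: field_simps)
  have "r \<le> 2 * (1 + r\<^sup>2 / 8)"
    using zero_le_power2[of "r / 2 - 1"] by (simp add: power2_eq_square field_simps)
  also have "\<dots> \<le> 2 * exp (r\<^sup>2 / 8)"
    by (intro mult_left_mono exp_ge_add_one_self) auto
  finally have "r * exp (- (r\<^sup>2 / 8)) \<le> 2"
    by (simp add: exp_minus field_simps)
  then have "(r * exp (- (r\<^sup>2 / 8))) * (exp (- (r\<^sup>2 / 8)) * (sqrt t * (2 * t) powr - (DIM('a) / 2))) \<le>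
      2 * (exp (- (r\<^sup>2 / 8)) * (sqrt t * (2 * t) powr - (DIM('a) / 2)))"
    using t by (intro mult_right_mono) auto
  moreover have "(2 * t) powr - (DIM('a) / 2) = 2 powr (DIM('a) / 2) * (2 * (2 * t)) powr - (DIM('a) / 2)"
  proof -
    have "(2 * (2 * t)) powr - (DIM('a) / 2) = 2 powr - (DIM('a) / 2) * (2 * t) powr - (DIM('a) / 2)"
      by (rule powr_mult)
    moreover have "2 powr (DIM('a) / 2) * 2 powr - (DIM('a) / 2) = (1 :: real)"
      by (simp flip: powr_add)
    ultimately show ?thesis by (simp only: mult.assoc[symmetric] mult_1)
  qed
  moreover have "heat_kernel t z = (2 * t) powr - (DIM('a) / 2) * (exp (- (r\<^sup>2 / 8)) * exp (- (r\<^sup>2 / 8)))"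
    unfolding heat_kernel_def e mult_exp_exp by simp
  moreover have "heat_kernel (2 * t) z = (2 * (2 * t)) powr - (DIM('a) / 2) * exp (- (r\<^sup>2 / 8))"
    unfolding heat_kernel_def e ..
  ultimately show ?thesis
    unfolding r(1) by (simp add: mult_ac)
qed

lemma lipschitz_const_nonneg:
  fixes h :: "'a::euclidean_space \<Rightarrow> 'b::real_normed_vector"
  assumes lip: "\<And>y y'. norm (h y - h y') \<le> L * norm (y - y')"
  shows "0 \<le> L"
proof -
  obtain b :: 'a where "b \<in> Basis" using nonempty_Basis by blast
  then have "0 \<le> L * norm (b - 0)" by (metis lip norm_ge_zero order.trans)
  then show ?thesis using \<open>b \<in> Basis\<close> by simp
qed

text \<open>Polarisation writes \<open>p \<bullet> q\<close> as the mean of the two squares minus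
  \<open>|p - q|^2 / 2\<close>. As the kernel has mass one, the mean contributes exactly the squared
  norm of \<open>h\<close>, and the defect is at most of order \<open>sqrt t\<close> because the
  kernel concentrates at distance \<open>sqrt t\<close>.\<close>

lemma heat_form_bounds:
  fixes h :: "'a::euclidean_space \<Rightarrow> quat"
  assumes t: "0 < t" and h: "integrable mu h" and h2: "integrable mu (\<lambda>y. (norm (h y))\<^sup>2)"
    and lip: "\<And>y y'. norm (h y - h y') \<le> L * norm (y - y')"
  defines "I \<equiv> \<integral>(y, y'). heat_kernel t (y - y') * (h y \<bullet> h y') \<partial>(mu \<Otimes>\<^sub>M mu)"
  shows "I \<le> (\<integral>y. (norm (h y))\<^sup>2 \<partial>mu)"
    and "(\<integral>y. (norm (h y))\<^sup>2 \<partial>mu) - L * (2 * 2 powr (DIM('a) / 2) * sqrt t) * (\<integral>y. norm (h y) \<partial>mu) \<le> I"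
proof -
  have [measurable]: "h \<in> borel_measurable borel" using borel_measurable_integrable[OF h] by simp
  let ?P = "mu \<Otimes>\<^sub>M mu :: ('a \<times> 'a) measure"
  define C where "C = 2 * 2 powr (DIM('a) / 2) * sqrt t"
  have C: "0 \<le> C" using t by (simp add: C_def)
  define k where "k z = C * heat_kernel (2 * t) z" for z :: 'a
  have k: "(\<integral>\<^sup>+z. ennreal (k z) \<partial>mu) = ennreal C"
    unfolding k_def using C t by (simp add: ennreal_mult' nn_integral_cmult nn_integral_heat_kernel)
  have L: "0 \<le> L" by (rule lipschitz_const_nonneg[OF lip])
  have n: "integrable mu (\<lambda>y. norm (h y))" using h by (rule integrable_norm)
  let ?S = "\<lambda>y. (norm (h y))\<^sup>2"
  have hk: "(\<integral>\<^sup>+z. ennreal (heat_kernel t (z::'a)) \<partial>mu) = ennreal 1"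
    using nn_integral_heat_kernel[OF t] by simp
  have S1: "has_bochner_integral ?P (\<lambda>(y, y'). heat_kernel t (y - y') * ?S y) (1 * integral\<^sup>L mu ?S)"
    by (intro has_bochner_integral_convolution hk h2) auto
  have S2: "has_bochner_integral ?P (\<lambda>(y, y'). heat_kernel t (y - y') * ?S y') (1 * integral\<^sup>L mu ?S)"
    by (intro has_bochner_integral_convolution' hk h2) auto
  have N1: "has_bochner_integral ?P (\<lambda>(y, y'). k (y - y') * norm (h y)) (C * integral\<^sup>L mu (\<lambda>y. norm (h y)))"
    by (intro has_bochner_integral_convolution k n) (auto simp: k_def[abs_def] C)
  have N2: "has_bochner_integral ?P (\<lambda>(y, y'). k (y - y') * norm (h y')) (C * integral\<^sup>L mu (\<lambda>y. norm (h y)))"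
    by (intro has_bochner_integral_convolution' k n) (auto simp: k_def[abs_def] C)
  have S: "has_bochner_integral ?P (\<lambda>z. ((case z of (y, y') \<Rightarrow> heat_kernel t (y - y') * ?S y) +
      (case z of (y, y') \<Rightarrow> heat_kernel t (y - y') * ?S y')) / 2) (integral\<^sup>L mu ?S)"
    using has_bochner_integral_divide_zero[OF has_bochner_integral_add[OF S1 S2], of 2] by simp
  have N: "has_bochner_integral ?P (\<lambda>z. ((case z of (y, y') \<Rightarrow> k (y - y') * norm (h y)) +
      (case z of (y, y') \<Rightarrow> k (y - y') * norm (h y'))) * (L / 2)) (L * C * integral\<^sup>L mu (\<lambda>y. norm (h y)))"
    using has_bochner_integral_mult_left[OF has_bochner_integral_add[OF N1 N2], of "L / 2"] by (simp add: mult_ac)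
  have ub: "\<bar>p \<bullet> q\<bar> \<le> ((norm p)\<^sup>2 + (norm q)\<^sup>2) / 2" for p q :: quat
    using Cauchy_Schwarz_ineq2[of p q] sum_squares_bound[of "norm p" "norm q"] by simp
  have I: "integrable ?P (\<lambda>(y, y'). heat_kernel t (y - y') * (h y \<bullet> h y'))"
  proof (rule Bochner_Integration.integrable_bound)
    show "integrable ?P (\<lambda>z. ((case z of (y, y') \<Rightarrow> heat_kernel t (y - y') * ?S y) +
      (case z of (y, y') \<Rightarrow> heat_kernel t (y - y') * ?S y')) / 2)"
      using S by (simp only: has_bochner_integral_iff)
    show "AE z in ?P. norm (case z of (y, y') \<Rightarrow> heat_kernel t (y - y') * (h y \<bullet> h y')) \<le>
      norm (((case z of (y, y') \<Rightarrow> heat_kernel t (y - y') * ?S y) +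
      (case z of (y, y') \<Rightarrow> heat_kernel t (y - y') * ?S y')) / 2)"
    proof (intro AE_I2, clarify)
      fix y y'
      have "heat_kernel t (y - y') * \<bar>h y \<bullet> h y'\<bar> \<le> heat_kernel t (y - y') * ((?S y + ?S y') / 2)"
        by (intro mult_left_mono ub) simp
      then show "norm (heat_kernel t (y - y') * (h y \<bullet> h y')) \<le>
        norm ((heat_kernel t (y - y') * ?S y + heat_kernel t (y - y') * ?S y') / 2)"
        by (simp add: abs_mult distrib_left)
    qed
  qed measurable
  show "I \<le> integral\<^sup>L mu ?S"
  proof -
    have "I \<le> (\<integral>z. ((case z of (y, y') \<Rightarrow> heat_kernel t (y - y') * ?S y) +
      (case z of (y, y') \<Rightarrow> heat_kernel t (y - y') * ?S y')) / 2 \<partial>?P)"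
      unfolding I_def
    proof (rule integral_mono[OF I])
      fix z :: "'a \<times> 'a"
      obtain y y' where z: "z = (y, y')" by (cases z)
      have "heat_kernel t (y - y') * (h y \<bullet> h y') \<le> heat_kernel t (y - y') * ((?S y + ?S y') / 2)"
        using ub[of "h y" "h y'"] by (intro mult_left_mono) auto
      then show "(case z of (y, y') \<Rightarrow> heat_kernel t (y - y') * (h y \<bullet> h y')) \<le>
        ((case z of (y, y') \<Rightarrow> heat_kernel t (y - y') * ?S y) +
         (case z of (y, y') \<Rightarrow> heat_kernel t (y - y') * ?S y')) / 2"
        by (simp add: z distrib_left)
    qed (use S in \<open>simp only: has_bochner_integral_iff\<close>)
    then show ?thesis using S by (simp only: has_bochner_integral_iff)
  qed
  show "integral\<^sup>L mu ?S - L * (2 * 2 powr (DIM('a) / 2) * sqrt t) * (\<integral>y. norm (h y) \<partial>mu) \<le> I"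
  proof -
    have D: "has_bochner_integral ?P (\<lambda>z. ((case z of (y, y') \<Rightarrow> heat_kernel t (y - y') * ?S y) +
      (case z of (y, y') \<Rightarrow> heat_kernel t (y - y') * ?S y')) / 2 -
      ((case z of (y, y') \<Rightarrow> k (y - y') * norm (h y)) +
      (case z of (y, y') \<Rightarrow> k (y - y') * norm (h y'))) * (L / 2))
      (integral\<^sup>L mu ?S - L * C * integral\<^sup>L mu (\<lambda>y. norm (h y)))"
      by (rule has_bochner_integral_diff[OF S N])
    have "(\<integral>z. ((case z of (y, y') \<Rightarrow> heat_kernel t (y - y') * ?S y) +
      (case z of (y, y') \<Rightarrow> heat_kernel t (y - y') * ?S y')) / 2 -
      ((case z of (y, y') \<Rightarrow> k (y - y') * norm (h y)) +
      (case z of (y, y') \<Rightarrow> k (y - y') * norm (h y'))) * (L / 2) \<partial>?P) \<le> I"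
      unfolding I_def
    proof (rule integral_mono[OF _ I])
      fix z :: "'a \<times> 'a"
      obtain y y' where z: "z = (y, y')" by (cases z)
      let ?d = "norm (y - y')" and ?n = "norm (h y) + norm (h y')"
      have 1: "h y \<bullet> h y' = (?S y + ?S y') / 2 - (norm (h y - h y'))\<^sup>2 / 2"
        by (simp add: power2_norm_eq_inner inner_diff_left inner_diff_right inner_commute field_simps)
      \<comment> \<open>Only one of the two factors is estimated by the Lipschitz bound. Using it
        for both would leave a function of \<open>y - y'\<close> alone, whose integral over the
        whole space diverges; the other factor keeps \<open>|h y| + |h y'|\<close>, which is
        integrable.\<close>
      have "(norm (h y - h y'))\<^sup>2 \<le> (L * ?d) * ?n"
        unfolding power2_eq_square using L by (intro mult_mono lip norm_triangle_ineq4) auto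
      then have "heat_kernel t (y - y') * (norm (h y - h y'))\<^sup>2 \<le> heat_kernel t (y - y') * ((L * ?d) * ?n)"
        by (intro mult_left_mono) auto
      also have "\<dots> = (?d * heat_kernel t (y - y')) * (L * ?n)" by simp
      also have "\<dots> \<le> k (y - y') * (L * ?n)"
        unfolding k_def C_def using L by (intro mult_right_mono norm_mult_heat_kernel_le t) auto
      finally show "((case z of (y, y') \<Rightarrow> heat_kernel t (y - y') * ?S y) +
        (case z of (y, y') \<Rightarrow> heat_kernel t (y - y') * ?S y')) / 2 -
        ((case z of (y, y') \<Rightarrow> k (y - y') * norm (h y)) +
        (case z of (y, y') \<Rightarrow> k (y - y') * norm (h y'))) * (L / 2) \<le>
        (case z of (y, y') \<Rightarrow> heat_kernel t (y - y') * (h y \<bullet> h y'))"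
        unfolding z prod.case 1 by (simp add: field_simps)
    qed (use D in \<open>simp only: has_bochner_integral_iff\<close>)
    then show ?thesis using D by (simp only: has_bochner_integral_iff C_def)
  qed
qed

text \<open>These properties hold for the product of \<open>f\<close> with the conjugated window at
  every position \<open>x\<close>, with one and the same \<open>L\<close>; the conclusions can
  therefore be integrated over \<open>x\<close>.\<close>

locale lipschitz_signal =
  fixes h :: "'a::euclidean_space \<times> 'a \<Rightarrow> quat" and L :: real
  assumes integrable: "integrable mu h"
    and integrable2: "integrable mu (\<lambda>y. (norm (h y))\<^sup>2)"
    and lipschitz: "\<And>y y'. norm (h y - h y') \<le> L * norm (y - y')"
begin

lemma measurable_qft' [measurable]: "qft h \<in> borel_measurable borel"
  by (rule measurable_qft[OF integrable])

lemma gaussian_qft_bounds: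
  assumes t: "0 < t"
  shows "(\<integral>w. exp (- (t * (norm w)\<^sup>2)) * (norm (qft h w))\<^sup>2 \<partial>mu) \<le> (\<integral>y. (norm (h y))\<^sup>2 \<partial>mu)"
    and "(\<integral>y. (norm (h y))\<^sup>2 \<partial>mu) - L * (2 * 2 powr (DIM('a \<times> 'a) / 2) * sqrt t) * (\<integral>y. norm (h y) \<partial>mu)
      \<le> (\<integral>w. exp (- (t * (norm w)\<^sup>2)) * (norm (qft h w))\<^sup>2 \<partial>mu)"
  using heat_form_bounds[OF t integrable integrable2 lipschitz] gaussian_qft[OF t integrable]
  unfolding has_bochner_integral_iff by auto

text \<open>The damped integrals increase as \<open>t\<close> decreases to 0, and the two Gaussian
  bounds squeeze them to the squared norm of \<open>h\<close>. Monotone convergence then gives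
  integrability and value at once.\<close>

lemma plancherel:
  "integrable mu (\<lambda>w. (norm (qft h w))\<^sup>2)"
  "(\<integral>w. (norm (qft h w))\<^sup>2 \<partial>mu) = (\<integral>y. (norm (h y))\<^sup>2 \<partial>mu)"
proof -
  define t where "t i = 1 / real (Suc i)" for i
  have t: "0 < t i" for i by (simp add: t_def)
  have t0: "t \<longlonglongrightarrow> 0" unfolding t_def by (rule LIMSEQ_Suc[OF lim_1_over_n])
  let ?F = "\<lambda>i w. exp (- (t i * (norm w)\<^sup>2)) * (norm (qft h w))\<^sup>2"
  have 1: "integrable mu (?F i)" for i
    using gaussian_qft[OF t integrable] by (simp add: has_bochner_integral_iff)
  have 2: "AE w in mu. mono (\<lambda>i. ?F i w)"
    by (intro AE_I2 monoI mult_right_mono) (auto simp: t_def field_simps intro!: mult_right_mono)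
  have 3: "AE w in mu. (\<lambda>i. ?F i w) \<longlonglongrightarrow> (norm (qft h w))\<^sup>2"
  proof (intro AE_I2)
    fix w
    have "(\<lambda>i. ?F i w) \<longlonglongrightarrow> exp (- (0 * (norm w)\<^sup>2)) * (norm (qft h w))\<^sup>2"
      by (intro tendsto_intros t0)
    then show "(\<lambda>i. ?F i w) \<longlonglongrightarrow> (norm (qft h w))\<^sup>2" by simp
  qed
  have 4: "(\<lambda>i. integral\<^sup>L mu (?F i)) \<longlonglongrightarrow> (\<integral>y. (norm (h y))\<^sup>2 \<partial>mu)"
  proof (rule tendsto_sandwich)
    show "\<forall>\<^sub>F i in sequentially. (\<integral>y. (norm (h y))\<^sup>2 \<partial>mu) -
      L * (2 * 2 powr (DIM('a \<times> 'a) / 2) * sqrt (t i)) * (\<integral>y. norm (h y) \<partial>mu) \<le> integral\<^sup>L mu (?F i)"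
      using gaussian_qft_bounds(2)[OF t] by (intro always_eventually allI)
    show "\<forall>\<^sub>F i in sequentially. integral\<^sup>L mu (?F i) \<le> (\<integral>y. (norm (h y))\<^sup>2 \<partial>mu)"
      using gaussian_qft_bounds(1)[OF t] by (intro always_eventually allI)
    have "(\<lambda>i. (\<integral>y. (norm (h y))\<^sup>2 \<partial>mu) -
      L * (2 * 2 powr (DIM('a \<times> 'a) / 2) * sqrt (t i)) * (\<integral>y. norm (h y) \<partial>mu)) \<longlonglongrightarrow>
      (\<integral>y. (norm (h y))\<^sup>2 \<partial>mu) - L * (2 * 2 powr (DIM('a \<times> 'a) / 2) * sqrt 0) * (\<integral>y. norm (h y) \<partial>mu)"
      by (intro tendsto_intros t0)
    then show "(\<lambda>i. (\<integral>y. (norm (h y))\<^sup>2 \<partial>mu) -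
      L * (2 * 2 powr (DIM('a \<times> 'a) / 2) * sqrt (t i)) * (\<integral>y. norm (h y) \<partial>mu)) \<longlonglongrightarrow>
      (\<integral>y. (norm (h y))\<^sup>2 \<partial>mu)" by simp
  qed simp
  show "integrable mu (\<lambda>w. (norm (qft h w))\<^sup>2)"
    by (rule integrable_monotone_convergence[OF 1 2 3 4]) measurable
  show "(\<integral>w. (norm (qft h w))\<^sup>2 \<partial>mu) = (\<integral>y. (norm (h y))\<^sup>2 \<partial>mu)"
    by (rule integral_monotone_convergence[OF 1 2 3 4]) measurable
qed

text \<open>For \<open>|w| \<ge> 1 / sqrt t\<close> the weight is at least
  \<open>1 - exp (- 1)\<close>, so this bounds the energy beyond frequency \<open>R\<close> by a
  multiple of \<open>1 / R\<close>, more than enough decay to integrate a logarithm.\<close>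

lemma gaussian_deficit:
  assumes t: "0 < t"
  shows "(\<integral>\<^sup>+w. ennreal ((1 - exp (- (t * (norm w)\<^sup>2))) * (norm (qft h w))\<^sup>2) \<partial>mu) \<le>
    ennreal (L * (2 * 2 powr (DIM('a \<times> 'a) / 2) * sqrt t) * (\<integral>y. norm (h y) \<partial>mu))"
proof -
  have 1: "(\<lambda>w. (1 - exp (- (t * (norm w)\<^sup>2))) * (norm (qft h w))\<^sup>2) =
    (\<lambda>w. (norm (qft h w))\<^sup>2 - exp (- (t * (norm w)\<^sup>2)) * (norm (qft h w))\<^sup>2)"
    by (simp add: left_diff_distrib)
  have 2: "integrable mu (\<lambda>w. exp (- (t * (norm w)\<^sup>2)) * (norm (qft h w))\<^sup>2)"
    using gaussian_qft[OF t integrable] by (simp add: has_bochner_integral_iff)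
  have "(\<integral>\<^sup>+w. ennreal ((1 - exp (- (t * (norm w)\<^sup>2))) * (norm (qft h w))\<^sup>2) \<partial>mu) =
    ennreal (\<integral>w. (1 - exp (- (t * (norm w)\<^sup>2))) * (norm (qft h w))\<^sup>2 \<partial>mu)"
  proof (rule nn_integral_eq_integral)
    show "integrable mu (\<lambda>w. (1 - exp (- (t * (norm w)\<^sup>2))) * (norm (qft h w))\<^sup>2)"
      unfolding 1 using plancherel(1) 2 by (rule Bochner_Integration.integrable_diff)
  qed (use t in auto)
  also have "(\<integral>w. (1 - exp (- (t * (norm w)\<^sup>2))) * (norm (qft h w))\<^sup>2 \<partial>mu) =
    (\<integral>y. (norm (h y))\<^sup>2 \<partial>mu) - (\<integral>w. exp (- (t * (norm w)\<^sup>2)) * (norm (qft h w))\<^sup>2 \<partial>mu)"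
    unfolding 1 using plancherel 2 by (simp add: Bochner_Integration.integral_diff)
  also have "ennreal \<dots> \<le> ennreal (L * (2 * 2 powr (DIM('a \<times> 'a) / 2) * sqrt t) * (\<integral>y. norm (h y) \<partial>mu))"
    using gaussian_qft_bounds(2)[OF t] by (intro ennreal_leI) linarith
  finally show ?thesis .
qed

end

text \<open>A dyadic decomposition: each \<open>k\<close> with \<open>2 ^ k \<le> r\<close>
  contributes at least \<open>1 - exp (- 1)\<close>, and there are at least \<open>ln r\<close> such
  \<open>k\<close>. The logarithm is thus dominated by deficits at the times
  \<open>(1 / 4) ^ k\<close>.\<close>

lemma ln_le_suminf_gaussian_deficit:
  fixes r :: real
  assumes "0 \<le> r"
  shows "ennreal (max 0 (ln r)) * ennreal (1 - exp (- 1)) \<le> (\<Sum>k. ennreal (1 - exp (- ((1 / 4) ^ k * r\<^sup>2))))"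
proof (cases "1 \<le> r")
  case True
  \<comment> \<open>The number of \<open>k\<close> with \<open>2 ^ k \<le> r\<close>. The
    \<open>Suc\<close> counts \<open>k = 0\<close> and makes up for the floor in
    \<open>log 2 r \<le> real m\<close>.\<close>
  define m where "m = Suc (nat \<lfloor>log 2 r\<rfloor>)"
  have lr: "0 \<le> log 2 r" using True by simp
  have "ln r \<le> log 2 r"
  proof -
    have "ln r * ln 2 \<le> ln r * 1"
      using True ln_2_less_1 by (intro mult_left_mono) auto
    then show ?thesis by (simp add: log_def field_simps)
  qed
  also have "log 2 r \<le> real m" using lr unfolding m_def by linarith
  finally have m: "ln r \<le> real m" .
  have "ennreal (max 0 (ln r)) * ennreal (1 - exp (- 1)) = ennreal (ln r * (1 - exp (- 1)))"
    using True by (simp add: ennreal_mult')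
  also have "\<dots> \<le> ennreal (\<Sum>k<m. 1 - exp (- 1))"
    using m by (intro ennreal_leI) (simp add: mult_right_mono)
  also have "\<dots> \<le> ennreal (\<Sum>k<m. 1 - exp (- ((1 / 4) ^ k * r\<^sup>2)))"
  proof (intro ennreal_leI sum_mono)
    fix k assume "k \<in> {..<m}"
    then have "real k \<le> log 2 r" using lr unfolding m_def by simp linarith
    then have "2 ^ k \<le> r" using True by (simp add: le_log_iff powr_realpow)
    then have "(2 ^ k)\<^sup>2 \<le> r\<^sup>2" by (intro power_mono) auto
    moreover have "(2 ^ k)\<^sup>2 = (4 :: real) ^ k"
      by (simp add: power2_eq_square flip: power_mult_distrib)
    ultimately have "1 \<le> (1 / 4) ^ k * r\<^sup>2"
      by (simp add: power_divide)
    then show "1 - exp (- 1) \<le> 1 - exp (- ((1 / 4) ^ k * r\<^sup>2))" by simp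
  qed
  also have "\<dots> = (\<Sum>k<m. ennreal (1 - exp (- ((1 / 4) ^ k * r\<^sup>2))))"
    by (rule sum_ennreal[symmetric]) simp
  also have "\<dots> \<le> (\<Sum>k. ennreal (1 - exp (- ((1 / 4) ^ k * r\<^sup>2))))"
    by (rule sum_le_suminf) auto
  finally show ?thesis .
next
  case False
  then have "ln r \<le> 0" using assms by (cases "r = 0") (auto simp: ln_le_zero_iff)
  then show ?thesis by simp
qed

text \<open>The factor \<open>2 * 2^(n/2)\<close> comes from the Gaussian deficit, another 2 from
  the geometric series over dyadic times, and \<open>1 - exp (- 1)\<close> from the pointwise bound
  on the logarithm. The type argument carries the dimension.\<close>

definition log_const :: "'a::euclidean_space itself \<Rightarrow> real" where
  "log_const _ = 4 * 2 powr (DIM('a) / 2) / (1 - exp (- 1))"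

text \<open>The dyadic bound is integrated term by term; at time \<open>(1 / 4) ^ k\<close> the
  deficit is of order \<open>(1 / 2) ^ k\<close>, which is summable. The result is linear in the
  integral of \<open>|h|\<close>, a quantity that is itself integrable over window
  positions.\<close>

lemma (in lipschitz_signal) nn_integral_ln_pos:
  "(\<integral>\<^sup>+w. ennreal (max 0 (ln (norm w)) * (norm (qft h w))\<^sup>2) \<partial>mu) \<le>
    ennreal (log_const TYPE('a \<times> 'a) * L * (\<integral>y. norm (h y) \<partial>mu))"
proof -
  let ?c = "1 - exp (- 1) :: real"
  have c: "0 < ?c" by simp
  define B where "B = L * (2 * 2 powr (DIM('a \<times> 'a) / 2)) * (\<integral>y. norm (h y) \<partial>mu)"
  have L: "0 \<le> L" by (rule lipschitz_const_nonneg[OF lipschitz])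
  have B: "0 \<le> B" unfolding B_def using L by (intro mult_nonneg_nonneg integral_nonneg_AE) auto
  have "ennreal ?c * (\<integral>\<^sup>+w. ennreal (max 0 (ln (norm w)) * (norm (qft h w))\<^sup>2) \<partial>mu) =
    (\<integral>\<^sup>+w. (ennreal (max 0 (ln (norm w))) * ennreal ?c) * ennreal ((norm (qft h w))\<^sup>2) \<partial>mu)"
    by (subst nn_integral_cmult[symmetric], measurable) (simp add: ennreal_mult mult_ac)
  also have "\<dots> \<le> (\<integral>\<^sup>+w. (\<Sum>k. ennreal (1 - exp (- ((1 / 4) ^ k * (norm w)\<^sup>2)))) * ennreal ((norm (qft h w))\<^sup>2) \<partial>mu)"
    by (intro nn_integral_mono mult_right_mono ln_le_suminf_gaussian_deficit) auto
  also have "\<dots> = (\<integral>\<^sup>+w. (\<Sum>k. ennreal ((1 - exp (- ((1 / 4) ^ k * (norm w)\<^sup>2))) * (norm (qft h w))\<^sup>2)) \<partial>mu)"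
    by (simp only: ennreal_suminf_multc[symmetric] ennreal_mult'' zero_le_power2)
  also have "\<dots> = (\<Sum>k. \<integral>\<^sup>+w. ennreal ((1 - exp (- ((1 / 4) ^ k * (norm w)\<^sup>2))) * (norm (qft h w))\<^sup>2) \<partial>mu)"
    by (rule nn_integral_suminf) measurable
  also have "\<dots> \<le> (\<Sum>k. ennreal (B * (1 / 2) ^ k))"
  proof (intro suminf_le summableI)
    fix k
    have "sqrt ((1 / 4) ^ k) = (1 / 2 :: real) ^ k"
      by (simp add: real_sqrt_power real_sqrt_divide)
    then show "(\<integral>\<^sup>+w. ennreal ((1 - exp (- ((1 / 4) ^ k * (norm w)\<^sup>2))) * (norm (qft h w))\<^sup>2) \<partial>mu) \<le> ennreal (B * (1 / 2) ^ k)"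
      using gaussian_deficit[of "(1 / 4) ^ k"] by (simp add: B_def mult_ac)
  qed
  also have "\<dots> = ennreal (\<Sum>k. B * (1 / 2) ^ k)"
    using B by (intro suminf_ennreal2) (auto intro!: summable_mult summable_geometric)
  also have "(\<Sum>k. B * (1 / 2) ^ k) = B * 2"
    by (subst suminf_mult) (auto intro!: summable_geometric simp: suminf_geometric)
  finally have "ennreal (1 / ?c) * (ennreal ?c * (\<integral>\<^sup>+w. ennreal (max 0 (ln (norm w)) * (norm (qft h w))\<^sup>2) \<partial>mu)) \<le>
    ennreal (1 / ?c) * ennreal (B * 2)"
    by (rule mult_left_mono) simp
  also have "ennreal (1 / ?c) * (ennreal ?c * (\<integral>\<^sup>+w. ennreal (max 0 (ln (norm w)) * (norm (qft h w))\<^sup>2) \<partial>mu)) =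
    (\<integral>\<^sup>+w. ennreal (max 0 (ln (norm w)) * (norm (qft h w))\<^sup>2) \<partial>mu)"
    unfolding mult.assoc[symmetric] using c by (subst ennreal_mult'[symmetric]) auto
  also have "ennreal (1 / ?c) * ennreal (B * 2) = ennreal (log_const TYPE('a \<times> 'a) * L * (\<integral>y. norm (h y) \<partial>mu))"
    using c by (subst ennreal_mult'[symmetric]) (auto simp: log_const_def B_def mult_ac)
  finally show ?thesis .
qed

section \<open>Pitt's inequality\<close>

text \<open>Schur test for the heat kernel with the weight \<open>norm y powr - (2 * a)\<close>; for the critical
  exponent \<open>a = n / 4\<close> this weight is the (non-normalizable) ground state of \<open>ln |x| + ln |D|\<close>.\<close>

lemma heat_form_le_schur:
  fixes h :: "'a::euclidean_space \<Rightarrow> quat"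
  assumes h: "integrable mu h"
  shows "ennreal (\<integral>(y, y'). heat_kernel t (y - y') * (h y \<bullet> h y') \<partial>(mu \<Otimes>\<^sub>M mu)) \<le>
    (\<integral>\<^sup>+y. \<integral>\<^sup>+y'. ennreal (heat_kernel t (y - y') * norm y' powr - (2 * a)) *
       ennreal (norm y powr (2 * a) * (norm (h y))\<^sup>2) \<partial>mu \<partial>mu)"
proof -
  have [measurable]: "h \<in> borel_measurable borel" using borel_measurable_integrable[OF h] by simp
  let ?P = "mu \<Otimes>\<^sub>M mu :: ('a \<times> 'a) measure"
  let ?F = "\<lambda>(y, y'). heat_kernel t (y - y') * (h y \<bullet> h y')"
  define A where "A y y' = ennreal (heat_kernel t (y - y') * norm y' powr - (2 * a)) *
       ennreal (norm y powr (2 * a) * (norm (h y))\<^sup>2)" for y y'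
  have [measurable]: "(\<lambda>(y, y'). A y y') \<in> borel_measurable (borel \<Otimes>\<^sub>M borel)"
    unfolding A_def by measurable
  have swap: "(\<integral>\<^sup>+y. \<integral>\<^sup>+y'. A y' y \<partial>mu \<partial>mu) = (\<integral>\<^sup>+y. \<integral>\<^sup>+y'. A y y' \<partial>mu \<partial>mu)"
    by (rule mu2.Fubini') measurable
  \<comment> \<open>If \<open>?F\<close> is not integrable, its Bochner integral is 0 and the bound
    holds trivially.\<close>
  have "ennreal (integral\<^sup>L ?P ?F) \<le> (\<integral>\<^sup>+z. ennreal (norm (?F z)) \<partial>?P)"
  proof (cases "integrable ?P ?F")
    case True
    have "ennreal (integral\<^sup>L ?P ?F) \<le> ennreal (norm (integral\<^sup>L ?P ?F))"
      by (intro ennreal_leI) simp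
    also have "\<dots> \<le> (\<integral>\<^sup>+z. ennreal (norm (?F z)) \<partial>?P)"
      by (rule integral_norm_bound_ennreal[OF True])
    finally show ?thesis .
  qed (simp add: not_integrable_integral_eq)
  also have "\<dots> = (\<integral>\<^sup>+y. \<integral>\<^sup>+y'. ennreal (norm (?F (y, y'))) \<partial>mu \<partial>mu)"
    by (rule mu.nn_integral_fst[symmetric]) measurable
  also have "\<dots> \<le> (\<integral>\<^sup>+y. \<integral>\<^sup>+y'. ennreal (1 / 2) * (A y y' + A y' y) \<partial>mu \<partial>mu)"
  proof (intro nn_integral_mono_AE eventually_mono[OF AE_mu_neq[of 0]])
    fix y y' :: 'a assume y: "y \<noteq> 0" "y' \<noteq> 0"
    define p q where "p = norm y powr (2 * a)" and "q = norm y' powr (2 * a)"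
    have pq: "0 < p" "0 < q" using y by (auto simp: p_def q_def)
    let ?k = "heat_kernel t (y - y')" and ?n = "norm (h y)" and ?n' = "norm (h y')"
    \<comment> \<open>The weighted arithmetic-geometric mean inequality, with the ratio of the
      weights at \<open>y\<close> and \<open>y'\<close>. Symmetry of the kernel makes the two
      resulting terms have equal integrals.\<close>
    have "2 * (?n * ?n') \<le> p / q * ?n\<^sup>2 + q / p * ?n'\<^sup>2"
      using zero_le_power2[of "p * ?n - q * ?n'"] pq
      by (simp add: field_simps power2_eq_square)
    then have "?n * ?n' \<le> (p / q * ?n\<^sup>2 + q / p * ?n'\<^sup>2) / 2" by simp
    then have "?k * (?n * ?n') \<le> ?k * ((p / q * ?n\<^sup>2 + q / p * ?n'\<^sup>2) / 2)"
      by (intro mult_left_mono) auto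
    moreover have "norm (?F (y, y')) \<le> ?k * (?n * ?n')"
      using Cauchy_Schwarz_ineq2[of "h y" "h y'"] by (simp add: abs_mult mult_left_mono)
    ultimately have "norm (?F (y, y')) \<le> ?k * ((p / q * ?n\<^sup>2 + q / p * ?n'\<^sup>2) / 2)"
      by (rule order_trans[rotated])
    also have "\<dots> = 1 / 2 * ((?k * norm y' powr - (2 * a)) * (p * ?n\<^sup>2) +
       (heat_kernel t (y' - y) * norm y powr - (2 * a)) * (q * ?n'\<^sup>2))"
      unfolding heat_kernel_minus_commute[of t y' y] powr_minus p_def[symmetric] q_def[symmetric]
      using pq by (simp add: field_simps)
    finally show "ennreal (norm (?F (y, y'))) \<le> ennreal (1 / 2) * (A y y' + A y' y)"
      unfolding A_def p_def q_def
      by (simp only: ennreal_mult'[symmetric] ennreal_plus[symmetric] powr_ge_zero heat_kernel_nonneg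
          zero_le_power2 mult_nonneg_nonneg ennreal_leI add_nonneg_nonneg zero_le_divide_1_iff zero_le_numeral)
  qed
  also have "\<dots> = ennreal (1 / 2) * ((\<integral>\<^sup>+y. \<integral>\<^sup>+y'. A y y' \<partial>mu \<partial>mu) + (\<integral>\<^sup>+y. \<integral>\<^sup>+y'. A y' y \<partial>mu \<partial>mu))"
    by (simp add: nn_integral_cmult nn_integral_add)
  also have "\<dots> = (\<integral>\<^sup>+y. \<integral>\<^sup>+y'. A y y' \<partial>mu \<partial>mu)"
  proof -
    have "ennreal (1 / 2) * 2 = 1"
      unfolding ennreal_numeral[symmetric] by (subst ennreal_mult'[symmetric]) simp_all
    then show ?thesis unfolding swap mult_2[symmetric] mult.assoc[symmetric] by (simp only: mult_1)
  qed
  finally show ?thesis unfolding A_def .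
qed

text \<open>The Schur test is applied at each time \<open>t\<close> before the integration over
  \<open>t\<close>; that integration then produces the Riesz potential of \<open>|y|^(-2a)\<close>.
  Its factor \<open>|y|^(2e - 2a)\<close> meets the Schur weight \<open>|y|^(2a)\<close>, and its
  \<open>Gamma e\<close> cancels the normalisation of \<open>|w|^(-2e)\<close>. All is done in
  \<open>ennreal\<close>, so the right side may be infinite.\<close>

lemma pitt_inequality:
  fixes h :: "'a::euclidean_space \<times> 'a \<Rightarrow> quat"
  defines "a \<equiv> DIM('a \<times> 'a) / 4"
  assumes h: "integrable mu h" and e: "0 < e" "e < a"
  shows "(\<integral>\<^sup>+w. ennreal (norm w powr - (2 * e) * (norm (qft h w))\<^sup>2) \<partial>mu) \<le>
    ennreal (pitt_const a e) * (\<integral>\<^sup>+y. ennreal (norm y powr (2 * e) * (norm (h y))\<^sup>2) \<partial>mu)"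
proof -
  have [measurable]: "h \<in> borel_measurable borel" using borel_measurable_integrable[OF h] by simp
  have [measurable]: "qft h \<in> borel_measurable borel" by (rule measurable_qft[OF h])
  have G: "0 < Gamma e" "0 < Gamma (a - e)" "0 < Gamma (a + e)"
    using e by (auto intro!: Gamma_real_pos)
  have C: "0 \<le> pitt_const a e" using G by (simp add: pitt_const_def)
  let ?\<phi> = "\<lambda>y. norm (y::'a \<times> 'a) powr - (2 * a)" and ?\<psi> = "\<lambda>y. norm y powr (2 * a) * (norm (h y))\<^sup>2"
  have "(\<integral>\<^sup>+w. ennreal (norm w powr - (2 * e) * (norm (qft h w))\<^sup>2) \<partial>mu) =
    (\<integral>\<^sup>+w. ennreal (1 / Gamma e) * (\<integral>\<^sup>+t. ennreal (t powr (e - 1)) * ennreal (exp (- (t * (norm w)\<^sup>2)) * (norm (qft h w))\<^sup>2) \<partial>half_line) \<partial>mu)"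
  proof (intro nn_integral_cong_AE eventually_mono[OF AE_mu_neq[of 0]])
    fix w :: "'a \<times> 'a" assume w: "w \<noteq> 0"
    have "ennreal (norm w powr - (2 * e) * (norm (qft h w))\<^sup>2) =
      ennreal (1 / Gamma e) * ((\<integral>\<^sup>+t. ennreal (t powr (e - 1) * exp (- (t * (norm w)\<^sup>2))) \<partial>half_line) * ennreal ((norm (qft h w))\<^sup>2))"
      unfolding ennreal_mult'[OF powr_ge_zero] norm_powr_eq_nn_integral[OF e(1) w] mult.assoc ..
    also have "(\<integral>\<^sup>+t. ennreal (t powr (e - 1) * exp (- (t * (norm w)\<^sup>2))) \<partial>half_line) * ennreal ((norm (qft h w))\<^sup>2) =
      (\<integral>\<^sup>+t. ennreal (t powr (e - 1)) * ennreal (exp (- (t * (norm w)\<^sup>2)) * (norm (qft h w))\<^sup>2) \<partial>half_line)"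
      by (subst nn_integral_multc[symmetric], measurable) (simp add: ennreal_mult'[symmetric] mult.assoc)
    finally show "ennreal (norm w powr - (2 * e) * (norm (qft h w))\<^sup>2) = ennreal (1 / Gamma e) * \<dots>" .
  qed
  also have "\<dots> = ennreal (1 / Gamma e) * (\<integral>\<^sup>+t. \<integral>\<^sup>+w. ennreal (t powr (e - 1)) * ennreal (exp (- (t * (norm w)\<^sup>2)) * (norm (qft h w))\<^sup>2) \<partial>mu \<partial>half_line)"
    by (subst nn_integral_cmult, measurable) (subst half_mu.Fubini', auto)
  also have "\<dots> \<le> ennreal (1 / Gamma e) * (\<integral>\<^sup>+t. \<integral>\<^sup>+y. ennreal (?\<psi> y) * (ennreal (t powr (e - 1)) *
      (\<integral>\<^sup>+y'. ennreal (heat_kernel t (y - y') * ?\<phi> y') \<partial>mu)) \<partial>mu \<partial>half_line)"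
  proof (rule mult_left_mono[OF nn_integral_mono_AE[OF eventually_mono[OF AE_half_line]]])
    fix t :: real assume t: "0 < t"
    note g = gaussian_qft[OF t h]
    have "(\<integral>\<^sup>+w. ennreal (t powr (e - 1)) * ennreal (exp (- (t * (norm w)\<^sup>2)) * (norm (qft h w))\<^sup>2) \<partial>mu) =
      ennreal (t powr (e - 1)) * ennreal (\<integral>(y, y'). heat_kernel t (y - y') * (h y \<bullet> h y') \<partial>(mu \<Otimes>\<^sub>M mu))"
      using g by (subst nn_integral_cmult, measurable)
        (subst nn_integral_eq_integral, auto simp: has_bochner_integral_iff)
    also have "\<dots> \<le> ennreal (t powr (e - 1)) * (\<integral>\<^sup>+y. \<integral>\<^sup>+y'. ennreal (heat_kernel t (y - y') * ?\<phi> y') * ennreal (?\<psi> y) \<partial>mu \<partial>mu)"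
      by (intro mult_left_mono heat_form_le_schur h) simp
    also have "\<dots> = (\<integral>\<^sup>+y. ennreal (?\<psi> y) * (ennreal (t powr (e - 1)) *
      (\<integral>\<^sup>+y'. ennreal (heat_kernel t (y - y') * ?\<phi> y') \<partial>mu)) \<partial>mu)"
      by (subst nn_integral_cmult[symmetric], measurable)
        (simp add: nn_integral_multc mult_ac)
    finally show "(\<integral>\<^sup>+w. ennreal (t powr (e - 1)) * ennreal (exp (- (t * (norm w)\<^sup>2)) * (norm (qft h w))\<^sup>2) \<partial>mu) \<le> \<dots>" .
  qed simp
  also have "(\<integral>\<^sup>+t. \<integral>\<^sup>+y. ennreal (?\<psi> y) * (ennreal (t powr (e - 1)) *
      (\<integral>\<^sup>+y'. ennreal (heat_kernel t (y - y') * ?\<phi> y') \<partial>mu)) \<partial>mu \<partial>half_line) =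
    (\<integral>\<^sup>+y. \<integral>\<^sup>+t. ennreal (?\<psi> y) * (ennreal (t powr (e - 1)) *
      (\<integral>\<^sup>+y'. ennreal (heat_kernel t (y - y') * ?\<phi> y') \<partial>mu)) \<partial>half_line \<partial>mu)"
    by (rule half_mu.Fubini'[symmetric]) measurable
  also have "\<dots> = (\<integral>\<^sup>+y. ennreal (Gamma e) * (ennreal (pitt_const a e) * ennreal (norm y powr (2 * e) * (norm (h y))\<^sup>2)) \<partial>mu)"
  proof (intro nn_integral_cong_AE eventually_mono[OF AE_mu_neq[of 0]])
    fix y :: "'a \<times> 'a" assume y: "y \<noteq> 0"
    have "(\<integral>\<^sup>+t. ennreal (?\<psi> y) * (ennreal (t powr (e - 1)) *
      (\<integral>\<^sup>+y'. ennreal (heat_kernel t (y - y') * ?\<phi> y') \<partial>mu)) \<partial>half_line) =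
      ennreal (?\<psi> y) * ennreal (Gamma e * pitt_const a e * norm y powr (2 * e - 2 * a))"
      using riesz_potential_inverse_power[OF e[unfolded a_def] y, folded a_def]
      by (simp add: nn_integral_cmult)
    also have "\<dots> = ennreal (?\<psi> y * (Gamma e * pitt_const a e * norm y powr (2 * e - 2 * a)))"
      by (rule ennreal_mult'[symmetric]) simp
    also have "?\<psi> y * (Gamma e * pitt_const a e * norm y powr (2 * e - 2 * a)) =
       Gamma e * (pitt_const a e * ((norm y powr (2 * a) * norm y powr (2 * e - 2 * a)) * (norm (h y))\<^sup>2))"
      by (simp only: mult_ac)
    also have "norm y powr (2 * a) * norm y powr (2 * e - 2 * a) = norm y powr (2 * e)"
      using y by (simp flip: powr_add)
    finally show "(\<integral>\<^sup>+t. ennreal (?\<psi> y) * (ennreal (t powr (e - 1)) *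
      (\<integral>\<^sup>+y'. ennreal (heat_kernel t (y - y') * ?\<phi> y') \<partial>mu)) \<partial>half_line) =
      ennreal (Gamma e) * (ennreal (pitt_const a e) * ennreal (norm y powr (2 * e) * (norm (h y))\<^sup>2))"
      using G C by (simp add: ennreal_mult')
  qed
  also have "\<dots> = ennreal (Gamma e) * (ennreal (pitt_const a e) * (\<integral>\<^sup>+y. ennreal (norm y powr (2 * e) * (norm (h y))\<^sup>2) \<partial>mu))"
    by (simp add: nn_integral_cmult)
  also have "ennreal (1 / Gamma e) * \<dots> = ennreal (pitt_const a e) * (\<integral>\<^sup>+y. ennreal (norm y powr (2 * e) * (norm (h y))\<^sup>2) \<partial>mu)"
  proof -
    have "ennreal (1 / Gamma e) * ennreal (Gamma e) = 1"
      using G by (simp add: ennreal_mult'[symmetric])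
    then show ?thesis unfolding mult.assoc[symmetric] by simp
  qed
  finally show ?thesis .
qed

section \<open>Schwartz functions\<close>

lemma schwartz_bound:
  "f \<in> schwartz \<Longrightarrow> set bs \<subseteq> Basis \<Longrightarrow> \<exists>C. \<forall>x. norm x ^ k * norm (iter_partial bs f x) \<le> C"
  unfolding schwartz_def by blast

lemma schwartz_decay:
  assumes "f \<in> schwartz"
  obtains C where "0 \<le> C" "\<And>x. norm x ^ k * norm (f x) \<le> C"
proof -
  from assms have "\<exists>C. \<forall>x. norm x ^ k * norm (iter_partial [] f x) \<le> C"
    by (intro schwartz_bound) auto
  then obtain C where C: "\<And>x. norm x ^ k * norm (f x) \<le> C" by (auto simp: iter_partial_def)
  moreover have "0 \<le> C" using C[of 0] order_trans[OF _ C[of 0]] by simp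
  ultimately show ?thesis using that by blast
qed

lemma schwartz_decay':
  assumes "f \<in> schwartz"
  obtains C where "0 \<le> C" "\<And>x. (1 + (norm x)\<^sup>2) ^ m * norm (f x) \<le> C"
proof -
  obtain C0 where C0: "0 \<le> C0" "\<And>x. norm x ^ 0 * norm (f x) \<le> C0"
    by (rule schwartz_decay[OF assms, where k=0]) blast
  obtain C1 where C1: "0 \<le> C1" "\<And>x. norm x ^ (2 * m) * norm (f x) \<le> C1"
    by (rule schwartz_decay[OF assms, where k="2 * m"]) blast
  have "(1 + (norm x)\<^sup>2) ^ m * norm (f x) \<le> 2 ^ m * (C0 + C1)" for x
  proof (cases "norm x \<le> 1")
    case True
    then have "(norm x)\<^sup>2 \<le> 1" by (simp add: power_le_one)
    then have "(1 + (norm x)\<^sup>2) ^ m * norm (f x) \<le> 2 ^ m * (C0 + C1)"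
      using C0(2)[of x] C1(1) by (intro mult_mono power_mono) auto
    then show ?thesis .
  next
    case False
    then have "1 \<le> (norm x)\<^sup>2" by (simp add: one_le_power)
    then have "(1 + (norm x)\<^sup>2) ^ m * norm (f x) \<le> (2 * (norm x)\<^sup>2) ^ m * norm (f x)"
      by (intro mult_right_mono power_mono) auto
    also have "\<dots> = 2 ^ m * (norm x ^ (2 * m) * norm (f x))"
      by (simp add: power_mult_distrib power_mult)
    also have "\<dots> \<le> 2 ^ m * (C0 + C1)" using C1(2)[of x] C0(1) by (intro mult_left_mono) auto
    finally show ?thesis .
  qed
  moreover have "0 \<le> 2 ^ m * (C0 + C1)" using C0 C1 by simp
  ultimately show ?thesis using that by blast
qed

lemma schwartz_differentiable:
  assumes "f \<in> schwartz"
  shows "f differentiable (at x)"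
  using assms unfolding schwartz_def smooth_def iter_partial_def
  by (metis (mono_tags, lifting) empty_set empty_subsetI foldr.simps(1) id_apply mem_Collect_eq)

lemma measurable_schwartz:
  fixes f :: "'a::euclidean_space \<Rightarrow> 'b::real_normed_vector"
  assumes "f \<in> schwartz"
  shows "f \<in> borel_measurable borel"
  by (intro borel_measurable_continuous_onI continuous_at_imp_continuous_on ballI
      differentiable_imp_continuous_within schwartz_differentiable assms)

text \<open>Decay of order \<open>k = 0\<close> for lists with one direction bounds each first
  partial derivative. These are the values of the total derivative on the basis, so the sum of the
  bounds dominates its operator norm, and the mean value inequality applies on the whole
  space.\<close>

lemma schwartz_lipschitz:
  fixes f :: "'a::euclidean_space \<Rightarrow> 'b::real_normed_vector"
  assumes f: "f \<in> schwartz"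
  obtains L where "0 \<le> L" "\<And>x y. norm (f x - f y) \<le> L * norm (x - y)"
proof -
  have "\<exists>C. \<forall>x. norm (partial_deriv b f x) \<le> C" if b: "b \<in> Basis" for b
  proof -
    have "\<exists>C. \<forall>x. norm x ^ 0 * norm (iter_partial [b] f x) \<le> C"
      using b by (intro schwartz_bound f) auto
    then show ?thesis by (simp add: iter_partial_def)
  qed
  then obtain C where C: "\<And>b x. b \<in> Basis \<Longrightarrow> norm (partial_deriv b f x) \<le> C b"
    by metis
  define D where "D x = frechet_derivative f (at x)" for x
  have D: "(f has_derivative D x) (at x)" for x
    unfolding D_def using schwartz_differentiable[OF f] frechet_derivative_works by blast
  have pd: "partial_deriv b f x = D x b" for b x
  proof -
    have "((\<lambda>h. f (x + h *\<^sub>R b)) has_derivative (\<lambda>h. D x (h *\<^sub>R b))) (at 0)"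
      by (rule has_derivative_compose[of "\<lambda>h. x + h *\<^sub>R b" "\<lambda>h. h *\<^sub>R b" 0 UNIV f "D x"])
        (auto intro!: derivative_eq_intros D)
    moreover have "D x (h *\<^sub>R b) = h *\<^sub>R D x b" for h
      using has_derivative_linear[OF D] by (simp add: linear_scale)
    ultimately show ?thesis
      unfolding partial_deriv_def by (intro vector_derivative_at) (simp add: has_vector_derivative_def)
  qed
  define L where "L = (\<Sum>b\<in>Basis. C b)"
  have on: "onorm (D x) \<le> L" for x
  proof (rule onorm_bound)
    show L0: "0 \<le> L" unfolding L_def using C order_trans[OF norm_ge_zero] by (intro sum_nonneg) blast
    fix v
    have "D x v = (\<Sum>b\<in>Basis. (v \<bullet> b) *\<^sub>R D x b)"
      using has_derivative_linear[OF D] euclidean_representation[of v]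
      by (metis (no_types, lifting) linear_scale linear_sum sum.cong)
    also have "norm \<dots> \<le> (\<Sum>b\<in>Basis. norm v * C b)"
      using C by (intro sum_norm_le) (auto simp: pd intro!: mult_mono Basis_le_norm)
    also have "\<dots> = L * norm v" by (simp add: L_def sum_distrib_left mult.commute)
    finally show "norm (D x v) \<le> L * norm v" .
  qed
  have "norm (f x - f y) \<le> L * norm (x - y)" for x y
    using differentiable_bound[of UNIV f D L x y] D on by auto
  moreover have "0 \<le> L" using on[of 0] onorm_pos_le[OF has_derivative_bounded_linear[OF D]] order_trans by blast
  ultimately show ?thesis using that by blast
qed

lemma integrable_schwartz:
  fixes f :: "'a::euclidean_space \<Rightarrow> quat"
  assumes f: "f \<in> schwartz"
  shows "integrable mu f"
proof -
  note [measurable] = measurable_schwartz[OF f]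
  \<comment> \<open>The power \<open>n\<close> of \<open>1 + |x|^2\<close> lies above the
    integrability threshold \<open>n / 2\<close>.\<close>
  obtain C where C: "0 \<le> C" "\<And>x. (1 + (norm x)\<^sup>2) ^ DIM('a) * norm (f x) \<le> C"
    by (rule schwartz_decay'[OF f, where m="DIM('a)"]) blast
  have bound: "norm (f x) \<le> C * (1 + (norm x)\<^sup>2) powr - real DIM('a)" for x
  proof -
    have "0 < 1 + (norm x)\<^sup>2" by (simp add: add_pos_nonneg)
    then show ?thesis using C(2)[of x] by (simp add: powr_minus powr_realpow field_simps)
  qed
  have "integrable mu (\<lambda>x::'a. C * (1 + (norm x)\<^sup>2) powr - real DIM('a))"
    using nn_integral_inverse_power_finite[where 'a='a and b="real DIM('a)"]
    by (intro integrable_mult_right integrableI_nonneg) auto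
  then show ?thesis
  proof (rule Bochner_Integration.integrable_bound)
    show "AE x in mu. norm (f x) \<le> norm (C * (1 + (norm x)\<^sup>2) powr - real DIM('a))"
      unfolding real_norm_def by (intro AE_I2 order_trans[OF bound abs_ge_self])
  qed measurable
qed

lemma integrable_schwartz_weighted:
  fixes f :: "'a::euclidean_space \<Rightarrow> quat"
  assumes f: "f \<in> schwartz"
  shows "integrable mu (\<lambda>y. norm y ^ k * (norm (f y))\<^sup>2)"
proof -
  note [measurable] = measurable_schwartz[OF f]
  obtain C where C: "0 \<le> C" "\<And>x. norm x ^ k * norm (f x) \<le> C"
    by (rule schwartz_decay[OF f, where k=k]) blast
  show ?thesis
  proof (rule Bochner_Integration.integrable_bound)
    show "integrable mu (\<lambda>y. C * norm (f y))"
      using integrable_schwartz[OF f] by simp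
    show "AE y in mu. norm (norm y ^ k * (norm (f y))\<^sup>2) \<le> norm (C * norm (f y))"
    proof (intro AE_I2)
      fix y
      have "(norm y ^ k * norm (f y)) * norm (f y) \<le> C * norm (f y)"
        by (intro mult_right_mono C) simp
      then show "norm (norm y ^ k * (norm (f y))\<^sup>2) \<le> norm (C * norm (f y))"
        using C(1) by (simp add: power2_eq_square mult.assoc)
    qed
  qed measurable
qed

lemma integrable_schwartz_inverse_norm:
  fixes f :: "'a::euclidean_space \<Rightarrow> quat"
  assumes f: "f \<in> schwartz" and n: "2 \<le> DIM('a)"
  shows "integrable mu (\<lambda>y. norm y powr - 1 * (norm (f y))\<^sup>2)"
proof -
  note [measurable] = measurable_schwartz[OF f]
  obtain C where C: "0 \<le> C" "\<And>x. norm x ^ 0 * norm (f x) \<le> C"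
    by (rule schwartz_decay[OF f, where k=0]) blast
  \<comment> \<open>Inside the unit ball \<open>exp 1 * exp (- |y|^2)\<close> is at least 1, so the
    first term dominates; outside it \<open>1 / |y|\<close> is at most 1 and the second term
    does.\<close>
  let ?b = "\<lambda>y::'a. C\<^sup>2 * exp 1 * (norm y powr - 1 * exp (- (norm y)\<^sup>2)) + (norm (f y))\<^sup>2"
  show ?thesis
  proof (rule Bochner_Integration.integrable_bound)
    show "integrable mu ?b"
    proof (intro Bochner_Integration.integrable_add integrable_mult_right)
      show "integrable mu (\<lambda>y::'a. norm y powr - 1 * exp (- (norm y)\<^sup>2))"
        using nn_integral_inverse_norm_gaussian_finite[OF n] by (intro integrableI_nonneg) auto
      show "integrable mu (\<lambda>y. (norm (f y))\<^sup>2)"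
        using integrable_schwartz_weighted[OF f, of 0] by simp
    qed
    show "AE y in mu. norm (norm y powr - 1 * (norm (f y))\<^sup>2) \<le> norm (?b y)"
    proof (intro AE_I2)
      fix y :: 'a
      have "norm y powr - 1 * (norm (f y))\<^sup>2 \<le> ?b y"
      proof (cases "norm y \<le> 1")
        case True
        then have "(norm y)\<^sup>2 \<le> 1" by (simp add: power_le_one)
        then have "1 \<le> exp (1 - (norm y)\<^sup>2)" by simp
        then have e: "1 \<le> exp 1 * exp (- (norm y)\<^sup>2)" by (simp add: mult_exp_exp)
        have "(norm (f y))\<^sup>2 * 1 \<le> C\<^sup>2 * (exp 1 * exp (- (norm y)\<^sup>2))"
          using C(2)[of y] e by (intro mult_mono power_mono) auto
        then have "norm y powr - 1 * ((norm (f y))\<^sup>2 * 1) \<le> norm y powr - 1 * (C\<^sup>2 * (exp 1 * exp (- (norm y)\<^sup>2)))"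
          by (intro mult_left_mono) auto
        then show ?thesis using zero_le_power2[of "norm (f y)"] by (simp only: mult_ac mult_1_right)
      next
        case False
        then have "0 < norm y" "1 \<le> norm y" by linarith+
        then have "norm y powr - 1 \<le> 1" by (simp add: powr_minus inverse_le_1_iff)
        then have "norm y powr - 1 * (norm (f y))\<^sup>2 \<le> 1 * (norm (f y))\<^sup>2" by (intro mult_right_mono) auto
        then show ?thesis by (simp add: add_increasing)
      qed
      then show "norm (norm y powr - 1 * (norm (f y))\<^sup>2) \<le> norm (?b y)" by simp
    qed
  qed measurable
qed

section \<open>The derivative at exponent zero\<close>

text \<open>The left side is the larger of \<open>r\<close> and \<open>1 / r\<close>. Their sum is
  the one majorant used for the logarithm, for powers with exponent in \<open>[-1, 1]\<close> and
  for difference quotients of powers.\<close>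

lemma exp_abs_ln_le: "0 < r \<Longrightarrow> exp \<bar>ln r\<bar> \<le> r + r powr - 1" for r :: real
  by (cases "0 \<le> ln r") (simp_all add: exp_minus powr_minus)

lemma abs_ln_le: "0 < r \<Longrightarrow> \<bar>ln r\<bar> \<le> r + r powr - 1" for r :: real
  using exp_abs_ln_le[of r] exp_ge_add_one_self[of "\<bar>ln r\<bar>"] by linarith

lemma powr_le_add_inverse:
  fixes r p :: real
  assumes "0 < r" "\<bar>p\<bar> \<le> 1"
  shows "r powr p \<le> r + r powr - 1"
proof -
  have "p * ln r \<le> \<bar>p\<bar> * \<bar>ln r\<bar>" by (simp add: abs_mult[symmetric])
  also have "\<dots> \<le> 1 * \<bar>ln r\<bar>" using assms by (intro mult_right_mono) auto
  finally have "r powr p \<le> exp \<bar>ln r\<bar>" using assms by (simp add: powr_def)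
  with exp_abs_ln_le[OF assms(1)] show ?thesis by linarith
qed

lemma abs_exp_minus_one_le: "\<bar>exp x - 1\<bar> \<le> \<bar>x\<bar> * exp \<bar>x\<bar>" for x :: real
proof (cases "0 \<le> x")
  case True
  have "(1 - x) * exp x \<le> exp (- x) * exp x"
    using exp_ge_add_one_self[of "- x"] by (intro mult_right_mono) auto
  then show ?thesis using True by (simp add: exp_minus algebra_simps)
next
  case False
  have "1 - exp x \<le> - x * 1" using exp_ge_add_one_self[of x] by linarith
  also have "\<dots> \<le> - x * exp (- x)" using False by (intro mult_left_mono) auto
  finally show ?thesis using False by simp
qed

text \<open>The allowance \<open>exp |ln r|\<close> is shared in two halves:
  \<open>e \<le> 1 / 4\<close> bounds \<open>exp (2 e |ln r|)\<close> by
  \<open>exp (|ln r| / 2)\<close>, and the other half absorbs the factor \<open>|ln r|\<close>. The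
  bound is uniform in \<open>e\<close>.\<close>

lemma powr_quotient_le:
  fixes r e :: real
  assumes r: "0 < r" and e: "0 < e" "e \<le> 1 / 4"
  shows "\<bar>(r powr (2 * e) - 1) / e\<bar> \<le> 4 * (r + r powr - 1)"
proof -
  let ?l = "\<bar>ln r\<bar>"
  have "\<bar>r powr (2 * e) - 1\<bar> \<le> \<bar>2 * e * ln r\<bar> * exp \<bar>2 * e * ln r\<bar>"
    using abs_exp_minus_one_le[of "2 * e * ln r"] r by (simp add: powr_def)
  also have "\<dots> = e * (2 * ?l * exp (2 * e * ?l))" using e by (simp add: abs_mult)
  also have "\<dots> \<le> e * (2 * (2 * exp (?l / 2)) * exp (?l / 2))"
  proof (intro mult_left_mono mult_mono)
    show "?l \<le> 2 * exp (?l / 2)" using exp_ge_add_one_self[of "?l / 2"] by linarith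
    have "2 * e * ?l \<le> 1 / 2 * ?l" using e by (intro mult_right_mono) auto
    then show "exp (2 * e * ?l) \<le> exp (?l / 2)" by simp
  qed (use e in auto)
  also have "\<dots> = e * (4 * exp ?l)"
    by (simp add: mult_exp_exp mult.assoc)
  also have "\<dots> \<le> e * (4 * (r + r powr - 1))"
    using exp_abs_ln_le[OF r] e by (intro mult_left_mono) auto
  finally show ?thesis using e by (simp add: abs_divide field_simps)
qed

lemma AE_mu_pos: "AE y in (mu :: 'a::euclidean_space measure). 0 < norm y"
  using AE_mu_neq[of "0::'a"] by simp

lemma integrable_schwartz_log:
  fixes f :: "'a::euclidean_space \<Rightarrow> quat"
  assumes f: "f \<in> schwartz" and n: "2 \<le> DIM('a)"
  shows "integrable mu (\<lambda>y. (norm y + norm y powr - 1) * (norm (f y))\<^sup>2)"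
    and "integrable mu (\<lambda>y. ln (norm y) * (norm (f y))\<^sup>2)"
    and "\<bar>p\<bar> \<le> 1 \<Longrightarrow> integrable mu (\<lambda>y. norm y powr p * (norm (f y))\<^sup>2)"
proof -
  note [measurable] = measurable_schwartz[OF f]
  show B: "integrable mu (\<lambda>y. (norm y + norm y powr - 1) * (norm (f y))\<^sup>2)"
    unfolding distrib_right
    using integrable_schwartz_weighted[OF f, of 1] integrable_schwartz_inverse_norm[OF f n]
    by (intro Bochner_Integration.integrable_add) simp_all
  show "integrable mu (\<lambda>y. ln (norm y) * (norm (f y))\<^sup>2)"
  proof (rule Bochner_Integration.integrable_bound[OF B])
    show "AE y in mu. norm (ln (norm y) * (norm (f y))\<^sup>2) \<le> norm ((norm y + norm y powr - 1) * (norm (f y))\<^sup>2)"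
      using AE_mu_pos
    proof eventually_elim
      case (elim y)
      then have "\<bar>ln (norm y)\<bar> * (norm (f y))\<^sup>2 \<le> (norm y + norm y powr - 1) * (norm (f y))\<^sup>2"
        by (intro mult_right_mono abs_ln_le) auto
      then show ?case by (simp add: abs_mult)
    qed
  qed measurable
  show "integrable mu (\<lambda>y. norm y powr p * (norm (f y))\<^sup>2)" if "\<bar>p\<bar> \<le> 1"
  proof (rule Bochner_Integration.integrable_bound[OF B])
    show "AE y in mu. norm (norm y powr p * (norm (f y))\<^sup>2) \<le> norm ((norm y + norm y powr - 1) * (norm (f y))\<^sup>2)"
      using AE_mu_pos
    proof eventually_elim
      case (elim y)
      then have "norm y powr p * (norm (f y))\<^sup>2 \<le> (norm y + norm y powr - 1) * (norm (f y))\<^sup>2"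
        using that by (intro mult_right_mono powr_le_add_inverse) auto
      then show ?case by (simp add: abs_mult)
    qed
  qed measurable
qed

text \<open>Dominated convergence along a sequence of exponents: \<open>powr_quotient_le\<close>
  supplies a majorant independent of \<open>k\<close>, and almost everywhere the limit is the
  derivative of \<open>r^(2e)\<close> at \<open>e = 0\<close>.\<close>

lemma power_weight_right_derivative:
  fixes f :: "'a::euclidean_space \<Rightarrow> quat"
  assumes f: "f \<in> schwartz" and n: "2 \<le> DIM('a)"
    and e: "\<And>k. 0 < e k" "\<And>k. e k \<le> 1 / 4" "e \<longlonglongrightarrow> 0"
  shows "(\<lambda>k. ((\<integral>y. norm y powr (2 * e k) * (norm (f y))\<^sup>2 \<partial>mu) - (\<integral>y. (norm (f y))\<^sup>2 \<partial>mu)) / e k) \<longlonglongrightarrow>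
    2 * (\<integral>y. ln (norm y) * (norm (f y))\<^sup>2 \<partial>mu)"
proof -
  note [measurable] = measurable_schwartz[OF f]
  have e1: "\<bar>2 * e k\<bar> \<le> 1" for k using e(1,2)[of k] by simp
  let ?q = "\<lambda>k y. ((norm y powr (2 * e k) - 1) / e k) * (norm (f y))\<^sup>2"
  have f2: "integrable mu (\<lambda>y. (norm (f y))\<^sup>2)"
    using integrable_schwartz_weighted[OF f, of 0] by simp
  have 1: "((\<integral>y. norm y powr (2 * e k) * (norm (f y))\<^sup>2 \<partial>mu) - (\<integral>y. (norm (f y))\<^sup>2 \<partial>mu)) / e k = (\<integral>y. ?q k y \<partial>mu)" for k
    by (subst Bochner_Integration.integral_diff[OF integrable_schwartz_log(3)[OF f n e1] f2, symmetric])
      (simp add: diff_divide_distrib left_diff_distrib flip: integral_divide_zero)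
  have 2: "(\<lambda>k. \<integral>y. ?q k y \<partial>mu) \<longlonglongrightarrow> (\<integral>y. 2 * (ln (norm y) * (norm (f y))\<^sup>2) \<partial>mu)"
  proof (rule integral_dominated_convergence)
    show "integrable mu (\<lambda>y. 4 * ((norm y + norm y powr - 1) * (norm (f y))\<^sup>2))"
      using integrable_schwartz_log(1)[OF f n] by simp
    show "AE y in mu. norm (?q k y) \<le> 4 * ((norm y + norm y powr - 1) * (norm (f y))\<^sup>2)" for k
      using AE_mu_pos
    proof eventually_elim
      case (elim y)
      have "\<bar>(norm y powr (2 * e k) - 1) / e k\<bar> * (norm (f y))\<^sup>2 \<le> (4 * (norm y + norm y powr - 1)) * (norm (f y))\<^sup>2"
        by (intro mult_right_mono powr_quotient_le elim e) simp
      then show ?case by (simp only: real_norm_def abs_mult abs_power2 mult.assoc)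
    qed
    show "AE y in mu. (\<lambda>k. ?q k y) \<longlonglongrightarrow> 2 * (ln (norm y) * (norm (f y))\<^sup>2)"
      using AE_mu_pos
    proof eventually_elim
      case (elim y)
      have "((\<lambda>x. norm y powr (2 * x)) has_real_derivative (2 * ln (norm y))) (at 0)"
        using elim by (auto intro!: derivative_eq_intros)
      then have "((\<lambda>h. (norm y powr (2 * h) - 1) / h) \<longlongrightarrow> 2 * ln (norm y)) (at 0)"
        using elim by (simp add: has_field_derivative_def[symmetric] DERIV_def)
      moreover have "filterlim e (at 0) sequentially"
        using e(1,3) by (auto simp: filterlim_at less_imp_neq[symmetric])
      ultimately have "(\<lambda>k. (norm y powr (2 * e k) - 1) / e k) \<longlonglongrightarrow> 2 * ln (norm y)"
        by (rule filterlim_compose)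
      then have "(\<lambda>k. ?q k y) \<longlonglongrightarrow> (2 * ln (norm y)) * (norm (f y))\<^sup>2"
        by (intro tendsto_mult_right)
      then show ?case by (simp only: mult.assoc)
    qed
  qed measurable
  then show ?thesis unfolding 1 by simp
qed

text \<open>At \<open>e = 0\<close> the quotient of Gammas is 1, so the derivative equals the
  logarithmic one, \<open>- ln 4 - 2 psi(a)\<close>. For \<open>a = d/2\<close> this is
  \<open>- 2\<close> times the constant of the theorem.\<close>

lemma pitt_const_derivative:
  assumes a: "0 < a"
  shows "(pitt_const a has_real_derivative (- 2 * (deriv Gamma a / Gamma a + ln 2))) (at 0)"
proof -
  have "a \<notin> \<int>\<^sub>\<le>\<^sub>0" using a by (auto elim!: nonpos_Ints_cases)
  then have G: "(Gamma has_real_derivative deriv Gamma a) (at a)"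
    using has_field_derivative_Gamma[of a] DERIV_imp_deriv by metis
  have g: "Gamma a > 0" using Gamma_real_pos[OF a] .
  have P: "((\<lambda>e. 4 powr - e) has_real_derivative - ln 4) (at 0)"
    by (auto intro!: derivative_eq_intros)
  have G1: "((\<lambda>e. Gamma (a - e)) has_real_derivative deriv Gamma a * (0 - 1)) (at 0)"
    by (rule DERIV_chain'[where g=Gamma, OF DERIV_diff[OF DERIV_const DERIV_ident]]) (use G in simp)
  have G2: "((\<lambda>e. Gamma (a + e)) has_real_derivative deriv Gamma a * (0 + 1)) (at 0)"
    by (rule DERIV_chain'[where g=Gamma, OF DERIV_add[OF DERIV_const DERIV_ident]]) (use G in simp)
  have "ln 4 = 2 * ln (2::real)" using ln_realpow[of "2::real" 2] by simp
  then show ?thesis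
    unfolding pitt_const_def[abs_def] using g
    by (intro DERIV_cong[OF DERIV_divide[OF DERIV_mult[OF P G1] G2]]) (simp_all add: field_simps)
qed

section \<open>Integration over the window position and conclusion\<close>

lemma AE_pair_mu_snd_neq: "AE z in (mu :: 'a::euclidean_space measure) \<Otimes>\<^sub>M (mu :: 'b::euclidean_space measure). snd z \<noteq> c"
proof (rule mu2.AE_pair_measure)
  show "{z \<in> space (mu \<Otimes>\<^sub>M mu). snd z \<noteq> c} \<in> sets ((mu :: 'a measure) \<Otimes>\<^sub>M (mu :: 'b measure))"
    by measurable
  show "AE x in (mu :: 'a measure). AE y in (mu :: 'b measure). snd (x, y) \<noteq> c"
    using AE_mu_neq[of c] by simp
qed

text \<open>For fixed \<open>y\<close> the integral of \<open>q (y - x)\<close> over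
  \<open>x\<close> does not depend on \<open>y\<close>, by reflection invariance. This is how the
  window splits off as a factor.\<close>

lemma nn_integral_mu_window:
  fixes p q :: "'a::euclidean_space \<Rightarrow> ennreal"
  assumes [measurable]: "p \<in> borel_measurable borel" "q \<in> borel_measurable borel"
  shows "(\<integral>\<^sup>+x. \<integral>\<^sup>+y. p y * q (y - x) \<partial>mu \<partial>mu) = (\<integral>\<^sup>+y. p y \<partial>mu) * (\<integral>\<^sup>+y. q y \<partial>mu)"
proof -
  have "(\<integral>\<^sup>+x. \<integral>\<^sup>+y. p y * q (y - x) \<partial>mu \<partial>mu) = (\<integral>\<^sup>+y. \<integral>\<^sup>+x. p y * q (y - x) \<partial>mu \<partial>mu)"
    by (rule mu2.Fubini') measurable
  also have "\<dots> = (\<integral>\<^sup>+y. p y * (\<integral>\<^sup>+x. q x \<partial>mu) \<partial>mu)"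
    by (simp add: nn_integral_cmult nn_integral_mu_reflect)
  finally show ?thesis by (simp add: nn_integral_multc)
qed

text \<open>Splits the integrability of the logarithm: the positive part is left to the decay at
  high frequencies, and the singularity at 0 is traded for an inverse power that Pitt's inequality
  controls.\<close>

lemma abs_ln_le_powr:
  fixes r e :: real
  assumes "0 \<le> r" "0 < e"
  shows "\<bar>ln r\<bar> \<le> max 0 (ln r) + r powr - (2 * e) / (2 * e)"
proof (cases "0 < r \<and> r < 1")
  case True
  have "- (2 * e) * ln r \<le> exp (- (2 * e) * ln r)"
    using exp_ge_add_one_self[of "- (2 * e) * ln r"] by linarith
  then show ?thesis using True assms by (simp add: powr_def field_simps)
next
  case False
  then have "r = 0 \<or> 1 \<le> r" using assms by linarith
  then show ?thesis using assms by auto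
qed

theorem theorem9:
  fixes f g :: "(real ^ 'd) \<times> (real ^ 'd) \<Rightarrow> quat"
  assumes "f \<in> schwartz" and "g \<in> schwartz"
  shows "(deriv Gamma (real CARD('d) / 2) / Gamma (real CARD('d) / 2) + ln 2)
           * (L2_norm_mu f)\<^sup>2 * (L2_norm_mu g)\<^sup>2
         \<le> (\<integral>(x, w). ln (norm w) * (norm (qwft g f x w))\<^sup>2 \<partial>(mu \<Otimes>\<^sub>M mu))
            + (L2_norm_mu g)\<^sup>2 * (\<integral>t. ln (norm t) * (norm (f t))\<^sup>2 \<partial>mu)"
proof -
  note [measurable] = measurable_schwartz[OF assms(1)] measurable_schwartz[OF assms(2)]
  define a where "a = real CARD('d) / 2"
  have a: "0 < a" by (simp add: a_def)
  have dim: "real DIM((real ^ 'd) \<times> (real ^ 'd)) / 4 = a" by (simp add: a_def)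
  have n: "2 \<le> DIM((real ^ 'd) \<times> (real ^ 'd))"
  proof -
    have "DIM((real ^ 'd) \<times> (real ^ 'd)) = CARD('d) + CARD('d)" by simp
    with zero_less_card_finite[where 'a='d] show ?thesis by linarith
  qed
  let ?P = "mu \<Otimes>\<^sub>M mu :: (((real ^ 'd) \<times> (real ^ 'd)) \<times> ((real ^ 'd) \<times> (real ^ 'd))) measure"

  define h where "h x y = f y * qcnj (g (y - x))" for x y
  have norm_h: "norm (h x y) = norm (f y) * norm (g (y - x))" for x y
    by (simp add: h_def norm_quat_mult)
  obtain Bf where Bf: "0 \<le> Bf" "\<And>x. norm x ^ 0 * norm (f x) \<le> Bf"
    by (rule schwartz_decay[OF assms(1), where k=0]) blast
  obtain Bg where Bg: "0 \<le> Bg" "\<And>x. norm x ^ 0 * norm (g x) \<le> Bg"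
    by (rule schwartz_decay[OF assms(2), where k=0]) blast
  obtain Lf where Lf: "0 \<le> Lf" "\<And>x y. norm (f x - f y) \<le> Lf * norm (x - y)"
    by (rule schwartz_lipschitz[OF assms(1)]) blast
  obtain Lg where Lg: "0 \<le> Lg" "\<And>x y. norm (g x - g y) \<le> Lg * norm (x - y)"
    by (rule schwartz_lipschitz[OF assms(2)]) blast
  have bf: "norm (f x) \<le> Bf" and bg: "norm (g x) \<le> Bg" for x
    using Bf(2)[of x] Bg(2)[of x] by simp_all
  \<comment> \<open>The product rule for Lipschitz functions. Translating \<open>g\<close> changes
    neither its bound nor its Lipschitz constant, so \<open>L\<close> does not depend on
    \<open>x\<close>.\<close>
  define L where "L = Bf * Lg + Lf * Bg"
  have L: "0 \<le> L" using Bf Bg Lf Lg by (simp add: L_def)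
  have f2: "integrable mu (\<lambda>y. (norm (f y))\<^sup>2)" and g2: "integrable mu (\<lambda>y. (norm (g y))\<^sup>2)"
    using integrable_schwartz_weighted[OF assms(1), of 0] integrable_schwartz_weighted[OF assms(2), of 0] by simp_all
  have f1: "integrable mu (\<lambda>y. norm (f y))" and g1: "integrable mu (\<lambda>y. norm (g y))"
    using assms by (intro integrable_norm integrable_schwartz; simp)+

  have sig: "lipschitz_signal (h x) L" for x
  proof
    show "integrable mu (h x)"
    proof (rule Bochner_Integration.integrable_bound)
      show "integrable mu (\<lambda>y. norm (f y) * Bg)" using f1 by simp
      show "AE y in mu. norm (h x y) \<le> norm (norm (f y) * Bg)"
        using Bg(1) by (intro AE_I2) (simp add: norm_h abs_mult mult_left_mono bg)
    qed (unfold h_def, measurable)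
    show "integrable mu (\<lambda>y. (norm (h x y))\<^sup>2)"
    proof (rule Bochner_Integration.integrable_bound)
      show "integrable mu (\<lambda>y. (norm (f y))\<^sup>2 * Bg\<^sup>2)" using f2 by simp
      show "AE y in mu. norm ((norm (h x y))\<^sup>2) \<le> norm ((norm (f y))\<^sup>2 * Bg\<^sup>2)"
        by (intro AE_I2) (simp add: norm_h abs_mult power_mult_distrib mult_left_mono power_mono bg)
    qed (unfold h_def, measurable)
    show "norm (h x y - h x y') \<le> L * norm (y - y')" for y y'
    proof -
      have "h x y - h x y' = f y * qcnj (g (y - x) - g (y' - x)) + (f y - f y') * qcnj (g (y' - x))"
        by (simp add: h_def qcnj_diff algebra_simps)
      then have "norm (h x y - h x y') \<le> norm (f y) * norm (g (y - x) - g (y' - x)) + norm (f y - f y') * norm (g (y' - x))"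
        by (metis norm_triangle_ineq norm_quat_mult norm_qcnj)
      also have "\<dots> \<le> Bf * (Lg * norm ((y - x) - (y' - x))) + (Lf * norm (y - y')) * Bg"
        using Bf(1) Lf(1) by (intro add_mono mult_mono bf bg Lf(2) Lg(2)) auto
      finally show ?thesis by (simp add: L_def algebra_simps)
    qed
  qed
  have hi: "integrable mu (h x)" for x using sig by (rule lipschitz_signal.integrable)

  define u where "u z = (norm (qft (h (fst z)) (snd z)))\<^sup>2" for z
  have u0: "0 \<le> u z" for z by (simp add: u_def)
  \<comment> \<open>Joint measurability in position and frequency, as Tonelli on the pair requires;
    measurability for each fixed \<open>x\<close> would not suffice.\<close>
  have [measurable]: "(\<lambda>z. qft (h (fst z)) (snd z)) \<in> borel_measurable ?P"
    unfolding qft_def h_def by (rule mu.borel_measurable_lebesgue_integral) measurable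
  have [measurable]: "u \<in> borel_measurable ?P" unfolding u_def by measurable
  have [measurable]: "qft (h x) \<in> borel_measurable borel" "h x \<in> borel_measurable borel" for x
    using measurable_qft[OF hi] borel_measurable_integrable[OF hi] by auto

  define nf ng where "nf = (\<integral>y. (norm (f y))\<^sup>2 \<partial>mu)" and "ng = (\<integral>y. (norm (g y))\<^sup>2 \<partial>mu)"
  have nfg: "0 \<le> nf" "0 \<le> ng" by (simp_all add: nf_def ng_def)
  have nn_ng: "(\<integral>\<^sup>+y. ennreal ((norm (g y))\<^sup>2) \<partial>mu) = ennreal ng"
    unfolding ng_def using g2 by (intro nn_integral_eq_integral) auto
  \<comment> \<open>The weight \<open>p\<close> depends on \<open>y\<close> only, so the integral
    over \<open>x\<close> falls on \<open>g\<close> alone. It is applied with \<open>p = 1\<close>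
    for Plancherel and with \<open>p = |y|^(2e)\<close> for Pitt's inequality.\<close>
  have window: "(\<integral>\<^sup>+x. \<integral>\<^sup>+y. ennreal (p y * (norm (h x y))\<^sup>2) \<partial>mu \<partial>mu) = ennreal (ng * (\<integral>y. p y * (norm (f y))\<^sup>2 \<partial>mu))"
    if p: "\<And>y. 0 \<le> p y" "integrable mu (\<lambda>y. p y * (norm (f y))\<^sup>2)" "p \<in> borel_measurable borel" for p
  proof -
    note [measurable] = p(3)
    have "(\<integral>\<^sup>+x. \<integral>\<^sup>+y. ennreal (p y * (norm (h x y))\<^sup>2) \<partial>mu \<partial>mu) =
      (\<integral>\<^sup>+x. \<integral>\<^sup>+y. ennreal (p y * (norm (f y))\<^sup>2) * ennreal ((norm (g (y - x)))\<^sup>2) \<partial>mu \<partial>mu)"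
      using p(1) by (simp add: norm_h power_mult_distrib ennreal_mult'[symmetric] mult.assoc)
    also have "\<dots> = (\<integral>\<^sup>+y. ennreal (p y * (norm (f y))\<^sup>2) \<partial>mu) * (\<integral>\<^sup>+y. ennreal ((norm (g y))\<^sup>2) \<partial>mu)"
      by (rule nn_integral_mu_window[where q="\<lambda>y. ennreal ((norm (g y))\<^sup>2)"]) measurable
    also have "(\<integral>\<^sup>+y. ennreal (p y * (norm (f y))\<^sup>2) \<partial>mu) = ennreal (\<integral>y. p y * (norm (f y))\<^sup>2 \<partial>mu)"
      using p by (intro nn_integral_eq_integral) auto
    finally show ?thesis
      unfolding nn_ng ennreal_mult'[OF nfg(2)] by (simp only: mult.commute)
  qed

  have U: "has_bochner_integral ?P u (nf * ng)"
  proof (rule has_bochner_integral_nn_integral)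
    have "(\<integral>\<^sup>+z. ennreal (u z) \<partial>?P) = (\<integral>\<^sup>+x. \<integral>\<^sup>+w. ennreal (u (x, w)) \<partial>mu \<partial>mu)"
      by (rule mu.nn_integral_fst[symmetric]) measurable
    also have "\<dots> = (\<integral>\<^sup>+x. \<integral>\<^sup>+y. ennreal (1 * (norm (h x y))\<^sup>2) \<partial>mu \<partial>mu)"
    proof (rule nn_integral_cong)
      fix x
      show "(\<integral>\<^sup>+w. ennreal (u (x, w)) \<partial>mu) = (\<integral>\<^sup>+y. ennreal (1 * (norm (h x y))\<^sup>2) \<partial>mu)"
        using lipschitz_signal.plancherel[OF sig[of x]] lipschitz_signal.integrable2[OF sig[of x]]
        by (simp add: u_def nn_integral_eq_integral)
    qed
    also have "\<dots> = ennreal (nf * ng)"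
      using f2 by (subst window) (simp_all add: nf_def mult.commute)
    finally show "(\<integral>\<^sup>+z. ennreal (u z) \<partial>?P) = ennreal (nf * ng)" .
  qed (use nfg u0 in auto)

  define J where "J e = (\<integral>y. norm y powr (2 * e) * (norm (f y))\<^sup>2 \<partial>mu)" for e
  have J0: "0 \<le> J e" for e by (simp add: J_def)
  have Cpos: "0 \<le> pitt_const a e" if "0 < e" "e < a" for e
    using that Gamma_real_pos[of "a - e"] Gamma_real_pos[of "a + e"] by (simp add: pitt_const_def)
  \<comment> \<open>The constant is the same for all \<open>x\<close>, so Pitt's inequality can be
    integrated over \<open>x\<close>. The bound \<open>e \<le> 1 / 4\<close> keeps
    \<open>2 * e\<close> in the range where the weighted integral \<open>J e\<close>
    converges.\<close>
  have pitt: "(\<integral>\<^sup>+z. ennreal (norm (snd z) powr - (2 * e) * u z) \<partial>?P) \<le> ennreal (pitt_const a e * (ng * J e))"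
    if e: "0 < e" "e < a" "e \<le> 1 / 4" for e
  proof -
    have "(\<integral>\<^sup>+z. ennreal (norm (snd z) powr - (2 * e) * u z) \<partial>?P) =
      (\<integral>\<^sup>+x. \<integral>\<^sup>+w. ennreal (norm (snd (x, w)) powr - (2 * e) * u (x, w)) \<partial>mu \<partial>mu)"
      by (rule mu.nn_integral_fst[symmetric]) measurable
    also have "\<dots> \<le> (\<integral>\<^sup>+x. ennreal (pitt_const a e) * (\<integral>\<^sup>+y. ennreal (norm y powr (2 * e) * (norm (h x y))\<^sup>2) \<partial>mu) \<partial>mu)"
      using pitt_inequality[OF hi e(1) e(2)[folded dim]]
      unfolding u_def dim by (intro nn_integral_mono) simp
    also have "\<dots> = ennreal (pitt_const a e) * (\<integral>\<^sup>+x. \<integral>\<^sup>+y. ennreal (norm y powr (2 * e) * (norm (h x y))\<^sup>2) \<partial>mu \<partial>mu)"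
      unfolding h_def by (rule nn_integral_cmult) measurable
    also have "(\<integral>\<^sup>+x. \<integral>\<^sup>+y. ennreal (norm y powr (2 * e) * (norm (h x y))\<^sup>2) \<partial>mu \<partial>mu) = ennreal (ng * J e)"
      unfolding J_def using e by (intro window integrable_schwartz_log(3) assms n) auto
    finally show ?thesis using Cpos[OF e(1,2)] by (simp add: ennreal_mult')
  qed

  \<comment> \<open>The bound for each \<open>x\<close> is a constant times the integral of
    \<open>|f y| |g (y - x)|\<close>; over all \<open>x\<close> this integrates to the product of
    the \<open>L^1\<close> norms of \<open>f\<close> and \<open>g\<close>.\<close>
  have lnpos: "(\<integral>\<^sup>+z. ennreal (max 0 (ln (norm (snd z))) * u z) \<partial>?P) < \<infinity>"
  proof -
    define K where "K = log_const TYPE((real ^ 'd) \<times> (real ^ 'd)) * L"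
    have K: "0 \<le> K" using L by (simp add: K_def log_const_def)
    have "(\<integral>\<^sup>+z. ennreal (max 0 (ln (norm (snd z))) * u z) \<partial>?P) =
      (\<integral>\<^sup>+x. \<integral>\<^sup>+w. ennreal (max 0 (ln (norm (snd (x, w)))) * u (x, w)) \<partial>mu \<partial>mu)"
      by (rule mu.nn_integral_fst[symmetric]) measurable
    also have "\<dots> \<le> (\<integral>\<^sup>+x. ennreal K * (\<integral>\<^sup>+y. ennreal (norm (f y)) * ennreal (norm (g (y - x))) \<partial>mu) \<partial>mu)"
    proof (rule nn_integral_mono)
      fix x
      have "(\<integral>\<^sup>+y. ennreal (norm (f y)) * ennreal (norm (g (y - x))) \<partial>mu) = ennreal (\<integral>y. norm (h x y) \<partial>mu)"
        by (subst nn_integral_eq_integral[symmetric])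
          (auto simp: norm_h[symmetric] ennreal_mult'[symmetric] intro: hi)
      then show "(\<integral>\<^sup>+w. ennreal (max 0 (ln (norm (snd (x, w)))) * u (x, w)) \<partial>mu) \<le>
        ennreal K * (\<integral>\<^sup>+y. ennreal (norm (f y)) * ennreal (norm (g (y - x))) \<partial>mu)"
        using lipschitz_signal.nn_integral_ln_pos[OF sig[of x]] K
        by (simp add: u_def K_def ennreal_mult')
    qed
    also have "\<dots> = ennreal K * ((\<integral>\<^sup>+y. ennreal (norm (f y)) \<partial>mu) * (\<integral>\<^sup>+y. ennreal (norm (g y)) \<partial>mu))"
      by (subst nn_integral_cmult, measurable)
        (subst nn_integral_mu_window[where q="\<lambda>y. ennreal (norm (g y))"], auto)
    also have "\<dots> < \<infinity>"
      using f1 g1 by (simp add: nn_integral_eq_integral ennreal_mult_less_top)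
    finally show ?thesis .
  qed

  define \<Lambda> where "\<Lambda> = (\<integral>z. ln (norm (snd z)) * u z \<partial>?P)"
  have ln_int: "integrable ?P (\<lambda>z. ln (norm (snd z)) * u z)"
  proof (rule Bochner_Integration.integrable_bound)
    \<comment> \<open>Any exponent satisfying both \<open>e0 < a\<close> and
      \<open>e0 \<le> 1 / 4\<close> would do; Pitt's inequality at \<open>e0\<close> handles
      \<open>|w| < 1\<close>.\<close>
    define e0 where "e0 = min (1 / 4) (a / 2)"
    have e0: "0 < e0" "e0 < a" "e0 \<le> 1 / 4" using a by (auto simp: e0_def)
    show "integrable ?P (\<lambda>z. max 0 (ln (norm (snd z))) * u z + norm (snd z) powr - (2 * e0) * u z / (2 * e0))"
    proof (intro Bochner_Integration.integrable_add integrable_divide)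
      show "integrable ?P (\<lambda>z. max 0 (ln (norm (snd z))) * u z)"
        using lnpos u0 by (intro integrableI_nonneg) auto
      show "integrable ?P (\<lambda>z. norm (snd z) powr - (2 * e0) * u z)"
        using le_less_trans[OF pitt[OF e0]] u0 by (intro integrableI_nonneg) auto
    qed
    show "AE z in ?P. norm (ln (norm (snd z)) * u z) \<le>
      norm (max 0 (ln (norm (snd z))) * u z + norm (snd z) powr - (2 * e0) * u z / (2 * e0))"
    proof (intro AE_I2)
      fix z
      have "\<bar>ln (norm (snd z))\<bar> * u z \<le> (max 0 (ln (norm (snd z))) + norm (snd z) powr - (2 * e0) / (2 * e0)) * u z"
        using abs_ln_le_powr[OF norm_ge_zero e0(1)] u0 by (intro mult_right_mono) auto
      also have "\<dots> \<le> norm \<dots>" by (simp only: real_norm_def abs_ge_self)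
      finally show "norm (ln (norm (snd z)) * u z) \<le>
        norm (max 0 (ln (norm (snd z))) * u z + norm (snd z) powr - (2 * e0) * u z / (2 * e0))"
        using u0[of z] by (simp add: abs_mult distrib_right)
    qed
  qed measurable

  \<comment> \<open>Convexity of the exponential replaces differentiation on the frequency side:
    \<open>1 - 2 e ln r \<le> r^(-2e)\<close> holds for every \<open>e\<close>, with equality at
    \<open>e = 0\<close>.\<close>
  have key: "nf * ng - 2 * e * \<Lambda> \<le> pitt_const a e * (ng * J e)"
    if e: "0 < e" "e < a" "e \<le> 1 / 4" for e
  proof -
    have r: "0 \<le> pitt_const a e * (ng * J e)" using Cpos[OF e(1,2)] nfg J0 by simp
    have i: "integrable ?P (\<lambda>z. norm (snd z) powr - (2 * e) * u z)"
      using le_less_trans[OF pitt[OF e]] u0 by (intro integrableI_nonneg) auto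
    have "(\<integral>z. u z - 2 * e * (ln (norm (snd z)) * u z) \<partial>?P) \<le> (\<integral>z. norm (snd z) powr - (2 * e) * u z \<partial>?P)"
    proof (rule integral_mono_AE)
      show "integrable ?P (\<lambda>z. u z - 2 * e * (ln (norm (snd z)) * u z))"
        using U ln_int by (simp add: has_bochner_integral_iff)
      show "AE z in ?P. u z - 2 * e * (ln (norm (snd z)) * u z) \<le> norm (snd z) powr - (2 * e) * u z"
        \<comment> \<open>At \<open>w = 0\<close> the pointwise bound fails under the conventions
          \<open>ln 0 = 0\<close> and \<open>0 powr p = 0\<close>, as it would read
          \<open>1 \<le> 0\<close> when \<open>u z > 0\<close>.\<close>
        using AE_pair_mu_snd_neq[of 0]
      proof eventually_elim
        case (elim z)
        have "1 + - (2 * e) * ln (norm (snd z)) \<le> norm (snd z) powr - (2 * e)"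
          using exp_ge_add_one_self[of "- (2 * e) * ln (norm (snd z))"] elim by (simp add: powr_def)
        then have "(1 + - (2 * e) * ln (norm (snd z))) * u z \<le> norm (snd z) powr - (2 * e) * u z"
          using u0 by (rule mult_right_mono)
        then show ?case by (simp add: algebra_simps)
      qed
    qed (rule i)
    also have "(\<integral>z. u z - 2 * e * (ln (norm (snd z)) * u z) \<partial>?P) = nf * ng - 2 * e * \<Lambda>"
      using U ln_int by (simp add: has_bochner_integral_iff \<Lambda>_def)
    also have "(\<integral>z. norm (snd z) powr - (2 * e) * u z \<partial>?P) \<le> pitt_const a e * (ng * J e)"
    proof -
      have "ennreal (\<integral>z. norm (snd z) powr - (2 * e) * u z \<partial>?P) = (\<integral>\<^sup>+z. ennreal (norm (snd z) powr - (2 * e) * u z) \<partial>?P)"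
        using i u0 by (intro nn_integral_eq_integral[symmetric]) auto
      with pitt[OF e] show ?thesis by (simp only: ennreal_le_iff[OF r, symmetric])
    qed
    finally show ?thesis .
  qed

  define M where "M = (\<integral>t. ln (norm t) * (norm (f t))\<^sup>2 \<partial>mu)"
  define D where "D = deriv Gamma a / Gamma a + ln 2"
  define \<epsilon> where "\<epsilon> k = min (1 / 4) (a / 2) / real (Suc k)" for k
  have \<epsilon>: "0 < \<epsilon> k" "\<epsilon> k \<le> 1 / 4" "\<epsilon> k < a" for k
  proof -
    have m: "0 < min (1 / 4) (a / 2)" using a by simp
    show "0 < \<epsilon> k" using m by (simp add: \<epsilon>_def)
    have "\<epsilon> k \<le> min (1 / 4) (a / 2)"
      unfolding \<epsilon>_def using m by (simp only: divide_le_eq) (simp add: mult_le_cancel_left1)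
    then show "\<epsilon> k \<le> 1 / 4" "\<epsilon> k < a" using a by auto
  qed
  have \<epsilon>0: "\<epsilon> \<longlonglongrightarrow> 0"
    unfolding \<epsilon>_def[abs_def] by (rule LIMSEQ_Suc[OF lim_const_over_n])
  have J': "(\<lambda>k. (J (\<epsilon> k) - nf) / \<epsilon> k) \<longlonglongrightarrow> 2 * M"
    unfolding J_def nf_def M_def by (rule power_weight_right_derivative[OF assms(1) n \<epsilon>(1,2) \<epsilon>0])
  have "filterlim \<epsilon> (at 0) sequentially"
    using \<epsilon>(1) \<epsilon>0 by (auto simp: filterlim_at less_imp_neq[symmetric])
  moreover have c0: "pitt_const a 0 = 1"
    using Gamma_real_pos[OF a] by (simp add: pitt_const_def)
  moreover have "((\<lambda>e. (pitt_const a (0 + e) - pitt_const a 0) / e) \<longlongrightarrow> - 2 * D) (at 0)"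
    using pitt_const_derivative[OF a] unfolding D_def DERIV_def .
  ultimately have C': "(\<lambda>k. (pitt_const a (\<epsilon> k) - 1) / \<epsilon> k) \<longlonglongrightarrow> - 2 * D"
    using filterlim_compose by fastforce
  have C: "(\<lambda>k. pitt_const a (\<epsilon> k)) \<longlonglongrightarrow> 1"
    using isCont_tendsto_compose[OF DERIV_isCont[OF pitt_const_derivative[OF a]] \<epsilon>0] c0 by simp
  \<comment> \<open>The product rule for difference quotients at \<open>e = 0\<close>, where
    \<open>C = 1\<close> and \<open>J = nf\<close>: the difference \<open>C J - nf\<close> is
    \<open>C (J - nf) + nf (C - 1)\<close>, with \<open>C\<close> short for
    \<open>pitt_const a (\<epsilon> k)\<close>.\<close>
  have "(\<lambda>k. ng * (pitt_const a (\<epsilon> k) * ((J (\<epsilon> k) - nf) / \<epsilon> k) + nf * ((pitt_const a (\<epsilon> k) - 1) / \<epsilon> k))) \<longlonglongrightarrow>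
    ng * (1 * (2 * M) + nf * (- 2 * D))"
    by (intro tendsto_intros C C' J')
  moreover have "- 2 * \<Lambda> \<le> ng * (pitt_const a (\<epsilon> k) * ((J (\<epsilon> k) - nf) / \<epsilon> k) + nf * ((pitt_const a (\<epsilon> k) - 1) / \<epsilon> k))" for k
  proof -
    have "- 2 * \<Lambda> * \<epsilon> k \<le> pitt_const a (\<epsilon> k) * (ng * J (\<epsilon> k)) - nf * ng"
      using key[OF \<epsilon>(1,3,2), of k] by (simp add: mult_ac)
    then have "- 2 * \<Lambda> \<le> (pitt_const a (\<epsilon> k) * (ng * J (\<epsilon> k)) - nf * ng) / \<epsilon> k"
      using \<epsilon>(1) by (simp only: le_divide_eq if_True)
    also have "\<dots> = ng * (pitt_const a (\<epsilon> k) * ((J (\<epsilon> k) - nf) / \<epsilon> k) + nf * ((pitt_const a (\<epsilon> k) - 1) / \<epsilon> k))"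
      using \<epsilon>(1)[of k] by (simp add: field_simps)
    finally show ?thesis .
  qed
  ultimately have "- 2 * \<Lambda> \<le> ng * (1 * (2 * M) + nf * (- 2 * D))"
    by (intro LIMSEQ_le_const) auto
  then have "D * nf * ng \<le> \<Lambda> + ng * M"
    by (simp add: algebra_simps)
  moreover have "(L2_norm_mu f)\<^sup>2 = nf" "(L2_norm_mu g)\<^sup>2 = ng"
    using nfg by (simp_all add: L2_norm_mu_def nf_def ng_def)
  moreover have "(\<integral>(x, w). ln (norm w) * (norm (qwft g f x w))\<^sup>2 \<partial>?P) = \<Lambda>"
    unfolding \<Lambda>_def u_def qwft_eq_qft h_def
    by (intro Bochner_Integration.integral_cong refl) (simp add: case_prod_unfold)
  ultimately show ?thesis
    unfolding D_def a_def M_def by (simp only:)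
qed

end
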